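(* Let $p$ be a prime, $n_1,n_2\geq 1$, $n=n_1+n_2$, $m\in\{1,2\}$, with $p$ odd if $m=2$. Let $\mathcal{P}=\mathbb{F}_p[x_1,\dots,x_n]$, $G_2=G(m,1,n_2)\le\operatorname{GL}_{n_2}(p)$, and $$G_I=\left\{\begin{pmatrix}A&B\\0&C\end{pmatrix}\ \Big|\ A\in\operatorname{GL}_{n_1}(p),\ C\in G_2,\ B\in \mathrm{Mat}_{n_1\times n_2}(\mathbb{F}_p)\right\}.$$ Then the monomial $$\prod_{j=1}^{n_1}x_j^{p^{n_1}-p^{n_1-j}-1}\cdot\prod_{j=1}^{n_2}x_{n_1+j}^{m(n_2+1-j)p^{n_1}-1}=x_1^{p^{n_1}-p^{n_1-1}-1}\cdots x_{n_1}^{p^{n_1}-2}\;x_{n_1+1}^{mn_2p^{n_1}-1}x_{n_1+2}^{m(n_2-1)p^{n_1}-1}\cdots x_n^{mp^{n_1}-1}$$ generates a block basis for $\mathcal{P}$ over $\mathcal{P}^{G_I}$.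
   Context: $G(m,1,n_2)$ is the group of monomial $n_2\times n_2$ matrices whose nonzero entries $w$ satisfy $w^m=1$; so $G(1,1,n_2)=S_{n_2}$ (permutation matrices) and $G(2,1,n_2)$ is the group of signed permutation matrices. (These $G_I$ are the Weyl groups of restricted Cartan type Lie algebras: $m=1$ for types $W$ and $S$, $m=2$ for type $H$.) $\operatorname{GL}_n(p)$ acts on $V=\langle x_1,\dots,x_n\rangle_{\mathbb{F}_p}=\mathbb{F}_p^n$ naturally, i.e. $g\cdot x_k=\sum_i g_{ik}x_i$, and on $\mathcal{P}=S^\bullet(V)$ by algebra automorphisms. A monomial $f\in\mathcal{P}$ generates a block basis for $\mathcal{P}$ over $\mathcal{P}^{G_I}$ if the set of all its monomial factors (monic monomial divisors) projects to an $\mathbb{F}_p$-basis of $\mathcal{P}/\mathcal{I}$, where $\mathcal{I}$ is the ideal generated by the homogeneous elements of $\mathcal{P}^{G_I}$ of positive degree. *)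

theory Defs
  imports
    "HOL-Library.Poly_Mapping"
    "HOL-Algebra.QuotRing"
    "HOL-Algebra.Divisibility"
    "Jordan_Normal_Form.VS_Connect"
    "Berlekamp_Zassenhaus.Finite_Field"
begin

hide_const (open) Multiset.mult Polynomial.smult

section \<open>Polynomials in \<open>x\<^sub>1, \<dots>, x\<^sub>n\<close>\<close>

text \<open>
  A polynomial maps exponent vectors (finitely supported functions from variable indices to
  exponents) to coefficients. The library multiplication on this type is the convolution, i.e. the
  multiplication of polynomials in countably many variables.
\<close>

type_synonym 'a mpol = "(nat \<Rightarrow>\<^sub>0 nat) \<Rightarrow>\<^sub>0 'a"

definition const_pol :: "'a :: zero \<Rightarrow> 'a mpol" where
  "const_pol c = Poly_Mapping.single 0 c"

definition pvar :: "nat \<Rightarrow> 'a :: zero_neq_one mpol" where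
  "pvar k = Poly_Mapping.single (Poly_Mapping.single k 1) 1"

text \<open>The ring \<open>\<P> = \<bbbF>[x\<^sub>1, \<dots>, x\<^sub>n]\<close>: only the variables with index in \<open>{1..n}\<close> occur.\<close>

definition poly_ring :: "nat \<Rightarrow> 'a :: comm_ring_1 mpol ring" where
  "poly_ring n =
    \<lparr>carrier = {f. \<forall>u\<in>Poly_Mapping.keys f. Poly_Mapping.keys u \<subseteq> {1..n}},
     mult = (*), one = 1, zero = 0, add = (+)\<rparr>"

definition monomials :: "nat \<Rightarrow> 'a :: comm_ring_1 mpol set" where
  "monomials n = {Poly_Mapping.single u 1 | u. Poly_Mapping.keys u \<subseteq> {1..n}}"

definition monomial_factors :: "nat \<Rightarrow> 'a :: comm_ring_1 mpol \<Rightarrow> 'a mpol set" where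
  "monomial_factors n f = {q \<in> monomials n. q divides\<^bsub>poly_ring n\<^esub> f}"

definition homogeneous :: "nat \<Rightarrow> 'a :: zero mpol \<Rightarrow> bool" where
  "homogeneous d f \<longleftrightarrow>
    (\<forall>u\<in>Poly_Mapping.keys f. (\<Sum>i\<in>Poly_Mapping.keys u. Poly_Mapping.lookup u i) = d)"


section \<open>Matrix groups and their action\<close>

definition GL :: "nat \<Rightarrow> 'a :: field mat set" where
  "GL n = {A \<in> carrier_mat n n. invertible_mat A}"

text \<open>\<open>G(m,1,n)\<close>: exactly one nonzero entry in each row and column, and \<open>w\<^sup>m = 1\<close> for it.\<close>

definition G_m1 :: "nat \<Rightarrow> nat \<Rightarrow> 'a :: field mat set" where
  "G_m1 m n = {C \<in> carrier_mat n n.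
     (\<forall>i<n. \<exists>!j. j < n \<and> C $$ (i, j) \<noteq> 0) \<and>
     (\<forall>j<n. \<exists>!i. i < n \<and> C $$ (i, j) \<noteq> 0) \<and>
     (\<forall>i<n. \<forall>j<n. C $$ (i, j) \<noteq> 0 \<longrightarrow> C $$ (i, j) ^ m = 1)}"

definition G_I :: "nat \<Rightarrow> nat \<Rightarrow> nat \<Rightarrow> 'a :: field mat set" where
  "G_I m n1 n2 = {four_block_mat A B (0\<^sub>m n2 n1) C | A B C.
     A \<in> GL n1 \<and> B \<in> carrier_mat n1 n2 \<and> C \<in> G_m1 m n2}"

text \<open>
  The algebra endomorphism with \<open>x\<^sub>k \<mapsto> \<Sum>\<^sub>i g\<^sub>i\<^sub>k x\<^sub>i\<close>. Matrix entries are indexed from 0,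
  variables from 1.
\<close>

definition act :: "nat \<Rightarrow> 'a :: field mat \<Rightarrow> 'a mpol \<Rightarrow> 'a mpol" where
  "act n g f =
    (\<Sum>u\<in>Poly_Mapping.keys f. const_pol (Poly_Mapping.lookup f u) *
      (\<Prod>k=1..n. (\<Sum>i=1..n. const_pol (g $$ (i - 1, k - 1)) * pvar i) ^ Poly_Mapping.lookup u k))"

definition invariants :: "nat \<Rightarrow> 'a :: field mat set \<Rightarrow> 'a mpol set" where
  "invariants n G = {f \<in> carrier (poly_ring n). \<forall>g\<in>G. act n g f = f}"


section \<open>Coinvariants and block bases\<close>

definition coinv_ideal :: "nat \<Rightarrow> 'a :: field mat set \<Rightarrow> 'a mpol set" where
  "coinv_ideal n G = Idl\<^bsub>poly_ring n\<^esub> {f \<in> invariants n G. \<exists>d>0. homogeneous d f}"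

text \<open>
  The quotient ring \<open>\<P>/I\<close> as an algebra over the coefficient field: \<open>c\<close> acts as multiplication by
  the class of the constant polynomial \<open>c\<close>.
\<close>

definition quot_alg :: "nat \<Rightarrow> 'a :: field mpol set \<Rightarrow> ('a, 'a mpol set) module" where
  "quot_alg n I = (let Q = poly_ring n Quot I in
    \<lparr>carrier = carrier Q, mult = mult Q, one = one Q, zero = zero Q, add = add Q,
     smult = (\<lambda>c X. (I +>\<^bsub>poly_ring n\<^esub> const_pol c) \<otimes>\<^bsub>Q\<^esub> X)\<rparr>)"

text \<open>
  The injectivity condition says that distinct monomial factors have distinct classes, so that the
  family of classes indexed by the factors, and not just the set of classes, is a basis.
\<close>

definition generates_block_basis :: "nat \<Rightarrow> 'a :: field mat set \<Rightarrow> 'a mpol \<Rightarrow> bool" where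
  "generates_block_basis n G f \<longleftrightarrow>
    (let I = coinv_ideal n G; proj = (\<lambda>q. I +>\<^bsub>poly_ring n\<^esub> q); B = monomial_factors n f in
     f \<in> monomials n \<and> inj_on proj B \<and>
     vectorspace.basis class_ring (quot_alg n I) (proj ` B))"

text \<open>
  The notion of basis lives in the locale of vector spaces; \<open>quot_alg n I\<close> is one for every
  ideal \<open>I\<close>.
\<close>

lemma poly_ring_simps:
  "mult (poly_ring n) = (*)" "one (poly_ring n) = 1" "zero (poly_ring n) = 0"
  "add (poly_ring n) = (+)"
  by (simp_all add: poly_ring_def)

lemma poly_ring_closed:
  fixes f g :: "'a :: comm_ring_1 mpol"
  shows "0 \<in> carrier (poly_ring n :: 'a mpol ring)"
    and "1 \<in> carrier (poly_ring n :: 'a mpol ring)"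
    and "f \<in> carrier (poly_ring n) \<Longrightarrow> - f \<in> carrier (poly_ring n)"
    and "f \<in> carrier (poly_ring n) \<Longrightarrow> g \<in> carrier (poly_ring n) \<Longrightarrow> f + g \<in> carrier (poly_ring n)"
    and "f \<in> carrier (poly_ring n) \<Longrightarrow> g \<in> carrier (poly_ring n) \<Longrightarrow> f * g \<in> carrier (poly_ring n)"
proof -
  have car: "h \<in> carrier (poly_ring n) \<longleftrightarrow>
      (\<forall>u\<in>Poly_Mapping.keys h. Poly_Mapping.keys u \<subseteq> {1..n})" for h :: "'a mpol"
    by (simp add: poly_ring_def)
  show "0 \<in> carrier (poly_ring n :: 'a mpol ring)" by (simp add: car)
  show "1 \<in> carrier (poly_ring n :: 'a mpol ring)" by (simp add: car)
  show "- f \<in> carrier (poly_ring n)" if "f \<in> carrier (poly_ring n)"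
    using that by (simp add: car)
  show "f + g \<in> carrier (poly_ring n)" if "f \<in> carrier (poly_ring n)" "g \<in> carrier (poly_ring n)"
    using that Poly_Mapping.keys_add[of f g] unfolding car by blast
  show "f * g \<in> carrier (poly_ring n)" if fg: "f \<in> carrier (poly_ring n)" "g \<in> carrier (poly_ring n)"
    unfolding car
  proof
    fix w assume "w \<in> Poly_Mapping.keys (f * g)"
    then obtain a b where w: "w = a + b"
      and "a \<in> Poly_Mapping.keys f" "b \<in> Poly_Mapping.keys g"
      using Poly_Mapping.keys_mult[of f g] by blast
    with fg have "Poly_Mapping.keys a \<subseteq> {1..n}" "Poly_Mapping.keys b \<subseteq> {1..n}"
      unfolding car by blast+
    then show "Poly_Mapping.keys w \<subseteq> {1..n}"
      unfolding w using Poly_Mapping.keys_add[of a b] by blast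
  qed
qed

lemma cring_poly_ring: "cring (poly_ring n :: 'a :: comm_ring_1 mpol ring)"
proof (rule cringI)
  show "abelian_group (poly_ring n :: 'a mpol ring)"
  proof (rule abelian_groupI)
    fix f assume "f \<in> carrier (poly_ring n :: 'a mpol ring)"
    then show "\<exists>g\<in>carrier (poly_ring n). g \<oplus>\<^bsub>poly_ring n\<^esub> f = \<zero>\<^bsub>poly_ring n\<^esub>"
      by (intro bexI[of _ "- f"]) (simp_all add: poly_ring_simps poly_ring_closed)
  qed (simp_all add: poly_ring_simps poly_ring_closed add_ac)
  show "comm_monoid (poly_ring n :: 'a mpol ring)"
    by (rule comm_monoidI) (simp_all add: poly_ring_simps poly_ring_closed mult_ac)
qed (simp add: poly_ring_simps distrib_right)

lemma const_pol_hom: "const_pol \<in> Ring.ring_hom class_ring (poly_ring n :: 'a :: field mpol ring)"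
  by (rule Ring.ring_hom_memI)
    (simp_all add: poly_ring_def const_pol_def Poly_Mapping.mult_single Poly_Mapping.single_add)

lemma vectorspace_quot_alg:
  fixes I :: "'a :: field mpol set"
  assumes "ideal I (poly_ring n)"
  shows "vectorspace class_ring (quot_alg n I)"
proof -
  interpret I: ideal I "poly_ring n" by fact
  let ?Q = "poly_ring n Quot I"
  let ?c = "\<lambda>c. I +>\<^bsub>poly_ring n\<^esub> const_pol c"
  interpret Q: cring ?Q
    by (rule I.quotient_is_cring[OF cring_poly_ring])
  have hom: "?c \<in> Ring.ring_hom class_ring ?Q"
    using ring_hom_trans[OF const_pol_hom I.rcos_ring_hom] by (simp add: comp_def)
  have smc: "?c a \<in> carrier ?Q" for a
    using ring_hom_closed[OF hom, of a] by simp
  have sma: "?c (a + b) = ?c a \<oplus>\<^bsub>?Q\<^esub> ?c b" for a b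
    using ring_hom_add[OF hom, of a b] by simp
  have smm: "?c (a * b) = ?c a \<otimes>\<^bsub>?Q\<^esub> ?c b" for a b
    using ring_hom_mult[OF hom, of a b] by simp
  have smo: "?c 1 = \<one>\<^bsub>?Q\<^esub>"
    using ring_hom_one[OF hom] by simp
  note simps = quot_alg_def Let_def
  have "abelian_group (quot_alg n I)"
  proof (rule abelian_groupI)
    fix X assume "X \<in> carrier (quot_alg n I)"
    then show "\<exists>Y\<in>carrier (quot_alg n I). Y \<oplus>\<^bsub>quot_alg n I\<^esub> X = \<zero>\<^bsub>quot_alg n I\<^esub>"
      by (intro bexI[of _ "\<ominus>\<^bsub>?Q\<^esub> X"]) (simp_all add: simps Q.l_neg)
  qed (simp_all add: simps Q.a_ac)
  then have "Module.module class_ring (quot_alg n I)"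
    by (intro Module.module.intro Module.module_axioms.intro class_cring.cring_axioms)
      (simp_all add: simps smc sma smm smo Q.l_distr Q.r_distr Q.m_assoc)
  then show ?thesis
    by (intro vectorspace.intro class_field.field_axioms)
qed

end

theory Submission
  imports Defs
begin

text \<open>
  The group permutes two sets of linear forms: those in \<open>x\<^sub>1, \<dots>, x\<^bsub>n1\<^esub>\<close>, and the sums of such a form
  and some \<open>w x\<^bsub>n1+j\<^esub>\<close> with \<open>w\<^sup>m = 1\<close>. For each of these sets \<open>\<Omega>\<close>, the coefficients of
  \<open>\<Prod>\<^bsub>w\<in>\<Omega>\<^esub> (X - w)\<close> below the top one are homogeneous invariants of positive degree. This yields,
  modulo the coinvariant ideal, monic relations for \<open>x\<^sub>n, \<dots>, x\<^bsub>n1+1\<^esub>, x\<^sub>1, \<dots>, x\<^bsub>n1\<^esub>\<close>, each with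
  coefficients in the variables further down this list, so that the factors of the given monomial
  span the coinvariants.

  There are at most as many factors as group elements. Conversely, monomials spanning the
  coinvariants span the polynomial ring over the invariants, by Nakayama's lemma. If there were fewer
  of them than group elements, then a homogeneous linear system would have a nonzero solution, which
  is a linear dependence between the distinct automorphisms in the group and contradicts Dedekind's
  lemma. So no proper subset of the factors spans the coinvariants, and they are a basis.
\<close>

section \<open>Polynomials, homogeneous components and the action\<close>

text \<open>Let q be the size of the field. The degree of the relation for a variable is the number
  of forms that remain after the forms in later variables have been divided off. For x_j with j <=
  n1 these are the q^n1 - q^(n1-j) forms in x_1, ..., x_n1 that involve some of x_1, ..., x_j. For
  x_(n1+j) they are the m (n2+1-j) q^n1 forms whose upper variable is one of x_(n1+j), ..., x_n.
  Without this division every variable of a set would get the full size of the set as its degree,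
  and there would be too many factors. The product of the reduced degrees is exactly the product of
  the orders of GL(n1), of the group of blocks B and of G(m,1,n2), so lower bounds for these orders
  close the argument. The order in which the variables are eliminated decides how the group order is
  distributed over the exponents, and is read off from the given monomial.\<close>

definition polys :: "nat set \<Rightarrow> 'a :: comm_ring_1 mpol set" where
  "polys T = {f. \<forall>u\<in>Poly_Mapping.keys f. Poly_Mapping.keys u \<subseteq> T}"

abbreviation mon :: "(nat \<Rightarrow>\<^sub>0 nat) \<Rightarrow> 'a :: comm_ring_1 mpol" where
  "mon u \<equiv> Poly_Mapping.single u 1"

lemma carrier_poly_ring: "carrier (poly_ring n) = polys {1..n}"
  by (simp add: poly_ring_def polys_def)

lemma polys_0 [simp]: "0 \<in> polys T"
  and polys_1 [simp]: "1 \<in> polys T"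
  and polys_const [simp]: "const_pol c \<in> polys T"
  by (auto simp: polys_def const_pol_def)

lemma polys_add [intro]: "f \<in> polys T \<Longrightarrow> g \<in> polys T \<Longrightarrow> f + g \<in> polys T"
  using Poly_Mapping.keys_add[of f g] unfolding polys_def by blast

lemma polys_uminus [intro]: "f \<in> polys T \<Longrightarrow> - f \<in> polys T"
  by (simp add: polys_def)

lemma polys_mult [intro]:
  assumes "f \<in> polys T" "g \<in> polys T"
  shows "f * g \<in> polys T"
  unfolding polys_def
proof (intro CollectI ballI)
  fix w assume "w \<in> Poly_Mapping.keys (f * g)"
  then obtain a b where w: "w = a + b" and "a \<in> Poly_Mapping.keys f" "b \<in> Poly_Mapping.keys g"
    using Poly_Mapping.keys_mult[of f g] by blast
  with assms have "Poly_Mapping.keys a \<subseteq> T" "Poly_Mapping.keys b \<subseteq> T"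
    unfolding polys_def by blast+
  then show "Poly_Mapping.keys w \<subseteq> T"
    unfolding w using Poly_Mapping.keys_add[of a b] by blast
qed

lemma polys_sum: "(\<And>i. i \<in> A \<Longrightarrow> f i \<in> polys T) \<Longrightarrow> (\<Sum>i\<in>A. f i) \<in> polys T"
  by (induction A rule: infinite_finite_induct) (auto simp: polys_add)

lemma polys_power: "f \<in> polys T \<Longrightarrow> f ^ k \<in> polys T"
  by (induction k) (auto simp: polys_mult)

lemma polys_pvar [intro]: "k \<in> T \<Longrightarrow> pvar k \<in> polys T"
  by (simp add: polys_def pvar_def)

lemma polys_mono: "T \<subseteq> T' \<Longrightarrow> polys T \<subseteq> polys T'"
  by (auto simp: polys_def)

lemma polys_mon: "Poly_Mapping.keys u \<subseteq> T \<Longrightarrow> Poly_Mapping.single u c \<in> polys T"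
  by (simp add: polys_def)

lemma const_pol_simps [simp]:
  "const_pol 0 = 0" "const_pol 1 = 1"
  by (simp_all add: const_pol_def)

lemma const_pol_add: "const_pol (a + b) = const_pol a + const_pol b"
  by (simp add: const_pol_def Poly_Mapping.single_add)

lemma const_pol_uminus: "const_pol (- a :: 'a :: comm_ring_1) = - const_pol a"
  by (simp add: const_pol_def Poly_Mapping.single_uminus)

lemma const_pol_mult: "const_pol (a * b :: 'a :: comm_ring_1) = const_pol a * const_pol b"
  by (simp add: const_pol_def Poly_Mapping.mult_single)

lemma const_pol_sum: "const_pol (\<Sum>i\<in>A. f i) = (\<Sum>i\<in>A. const_pol (f i :: 'a :: comm_ring_1))"
  by (induction A rule: infinite_finite_induct) (auto simp: const_pol_add)

lemma single_eq: "Poly_Mapping.single u c = const_pol c * mon u" for c :: "'a :: comm_ring_1"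
  by (simp add: const_pol_def Poly_Mapping.mult_single)

lemma mon_add: "mon (u + v) = (mon u * mon v :: 'a :: comm_ring_1 mpol)"
  by (simp add: Poly_Mapping.mult_single)

lemma poly_sum_monomials:
  "(\<Sum>u\<in>Poly_Mapping.keys f. Poly_Mapping.single u (Poly_Mapping.lookup f u)) = f"
  by (rule poly_mapping_eqI)
    (simp add: Poly_Mapping.lookup_sum Poly_Mapping.lookup_single when_def in_keys_iff)

text \<open>Recording that the exponents come from \<open>K\<close> lets an induction step use which
  variables they involve.\<close>

lemma mpol_induct_on [consumes 1, case_names zero add]:
  fixes P :: "'a :: comm_ring_1 mpol \<Rightarrow> bool"
  assumes "Poly_Mapping.keys f \<subseteq> K"
    and "P 0" "\<And>f u c. u \<in> K \<Longrightarrow> P f \<Longrightarrow> P (Poly_Mapping.single u c + f)"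
  shows "P f"
proof -
  have "P (\<Sum>u\<in>A. Poly_Mapping.single u (Poly_Mapping.lookup f u))" if "finite A" "A \<subseteq> K" for A
    using that by (induction A rule: finite_induct) (auto intro!: assms)
  from this[of "Poly_Mapping.keys f"] show ?thesis
    using assms(1) by (simp add: poly_sum_monomials)
qed

lemmas mpol_induct [case_names zero add] = mpol_induct_on[OF subset_UNIV]

lemma mon_pvar_power: "mon (Poly_Mapping.single k e) = (pvar k ^ e :: 'a :: comm_ring_1 mpol)"
proof (induction e)
  case (Suc e)
  have "Poly_Mapping.single k (Suc e) = Poly_Mapping.single k e + Poly_Mapping.single k 1"
    by (simp flip: Poly_Mapping.single_add)
  then show ?case
    by (simp only: mon_add Suc) (simp add: pvar_def mult.commute)
qed simp

lemma mon_eq_prod: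
  assumes "finite T" "Poly_Mapping.keys u \<subseteq> T"
  shows "(mon u :: 'a :: comm_ring_1 mpol) = (\<Prod>k\<in>T. pvar k ^ Poly_Mapping.lookup u k)"
proof -
  have *: "(mon (\<Sum>k\<in>A. h k) :: 'a mpol) = (\<Prod>k\<in>A. mon (h k))" for A :: "nat set" and h
    by (induction A rule: infinite_finite_induct) (auto simp: mon_add)
  have "u = (\<Sum>k\<in>T. Poly_Mapping.single k (Poly_Mapping.lookup u k))"
    using assms by (intro poly_mapping_eqI)
      (auto simp: Poly_Mapping.lookup_sum Poly_Mapping.lookup_single when_def in_keys_iff)
  then have "(mon u :: 'a mpol) = mon (\<Sum>k\<in>T. Poly_Mapping.single k (Poly_Mapping.lookup u k))"
    by simp
  then show ?thesis
    by (simp add: * mon_pvar_power)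
qed

section \<open>Degrees of exponents and homogeneous components\<close>

definition mdeg :: "(nat \<Rightarrow>\<^sub>0 nat) \<Rightarrow> nat" where
  "mdeg u = (\<Sum>i\<in>Poly_Mapping.keys u. Poly_Mapping.lookup u i)"

lemma homogeneous_iff: "homogeneous d f \<longleftrightarrow> (\<forall>u\<in>Poly_Mapping.keys f. mdeg u = d)"
  by (simp add: homogeneous_def mdeg_def)

lemma mdeg_superset:
  "finite A \<Longrightarrow> Poly_Mapping.keys u \<subseteq> A \<Longrightarrow> mdeg u = (\<Sum>i\<in>A. Poly_Mapping.lookup u i)"
  unfolding mdeg_def by (rule sum.mono_neutral_left) (auto simp: in_keys_iff)

lemma mdeg_add: "mdeg (u + v) = mdeg u + mdeg v"
proof -
  let ?A = "Poly_Mapping.keys u \<union> Poly_Mapping.keys v"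
  have "mdeg (u + v) = (\<Sum>i\<in>?A. Poly_Mapping.lookup (u + v) i)"
    by (rule mdeg_superset) (use Poly_Mapping.keys_add[of u v] in auto)
  then show ?thesis
    using mdeg_superset[of ?A u] mdeg_superset[of ?A v]
    by (simp add: Poly_Mapping.lookup_add sum.distrib)
qed

lemma homogeneous_0 [simp]: "homogeneous d 0"
  by (simp add: homogeneous_iff)

lemma homogeneous_add: "homogeneous d f \<Longrightarrow> homogeneous d g \<Longrightarrow> homogeneous d (f + g)"
  using Poly_Mapping.keys_add[of f g] unfolding homogeneous_iff by blast

lemma homogeneous_sum: "(\<And>i. i \<in> A \<Longrightarrow> homogeneous d (f i)) \<Longrightarrow> homogeneous d (\<Sum>i\<in>A. f i)"
  by (induction A rule: infinite_finite_induct) (auto simp: homogeneous_add)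

lemma homogeneous_uminus: "homogeneous d f \<Longrightarrow> homogeneous d (- f :: 'a :: comm_ring_1 mpol)"
  by (simp add: homogeneous_iff)

lemma homogeneous_mult:
  "homogeneous d f \<Longrightarrow> homogeneous e g \<Longrightarrow> homogeneous (d + e) (f * g :: 'a :: comm_ring_1 mpol)"
  using Poly_Mapping.keys_mult[of f g] unfolding homogeneous_iff by (force simp: mdeg_add)

lemma homogeneous_const: "homogeneous 0 (const_pol c)"
  by (simp add: homogeneous_iff const_pol_def mdeg_def)

lemma homogeneous_pvar: "homogeneous 1 (pvar k)"
  by (simp add: homogeneous_iff pvar_def mdeg_def)

lemma homogeneous_single: "homogeneous (mdeg u) (Poly_Mapping.single u c)"
  by (simp add: homogeneous_iff)

definition hcomp :: "nat \<Rightarrow> 'a :: comm_ring_1 mpol \<Rightarrow> 'a mpol" where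
  "hcomp d f = (\<Sum>u\<in>{u\<in>Poly_Mapping.keys f. mdeg u = d}.
     Poly_Mapping.single u (Poly_Mapping.lookup f u))"

lemma lookup_hcomp:
  "Poly_Mapping.lookup (hcomp d f) u = (if mdeg u = d then Poly_Mapping.lookup f u else 0)"
  by (simp add: hcomp_def Poly_Mapping.lookup_sum Poly_Mapping.lookup_single when_def in_keys_iff)

lemma keys_hcomp: "Poly_Mapping.keys (hcomp d f) = {u \<in> Poly_Mapping.keys f. mdeg u = d}"
  by (auto simp: in_keys_iff lookup_hcomp split: if_splits)

lemma hcomp_add: "hcomp d (f + g) = hcomp d f + hcomp d g"
  by (rule poly_mapping_eqI) (simp add: lookup_hcomp Poly_Mapping.lookup_add)

lemma hcomp_0 [simp]: "hcomp d 0 = 0"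
  by (simp add: hcomp_def)

lemma hcomp_sum: "hcomp d (\<Sum>i\<in>A. f i) = (\<Sum>i\<in>A. hcomp d (f i))"
  by (induction A rule: infinite_finite_induct) (auto simp: hcomp_add)

lemma hcomp_homogeneous: "homogeneous e f \<Longrightarrow> hcomp d f = (if d = e then f else 0)"
  by (rule poly_mapping_eqI) (auto simp: lookup_hcomp homogeneous_iff in_keys_iff)

text \<open>Multiplication by a form of degree \<open>e\<close> shifts components by
  \<open>e\<close>. The test \<open>e \<le> d\<close> keeps the truncated difference
  \<open>d - e\<close> from contributing a spurious component of degree 0.\<close>

lemma hcomp_mult:
  fixes f h :: "'a :: comm_ring_1 mpol"
  assumes "homogeneous e f"
  shows "hcomp d (h * f) = (if e \<le> d then hcomp (d - e) h * f else 0)"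
proof (induction h rule: mpol_induct)
  case (add h u c)
  have "hcomp d (Poly_Mapping.single u c * f)
      = (if e \<le> d then hcomp (d - e) (Poly_Mapping.single u c) * f else 0)"
    unfolding hcomp_homogeneous[OF homogeneous_mult[OF homogeneous_single assms]]
      hcomp_homogeneous[OF homogeneous_single] by auto
  with add show ?case
    by (auto simp: hcomp_add algebra_simps)
qed auto

lemma sum_hcomp: "\<exists>D. f = (\<Sum>d\<le>D. hcomp d f)"
proof -
  \<comment> \<open>The inserted 0 keeps the maximum defined for the zero polynomial.\<close>
  let ?D = "Max (insert 0 (mdeg ` Poly_Mapping.keys f))"
  have le: "mdeg u \<le> ?D" if "u \<in> Poly_Mapping.keys f" for u
    using that by (intro Max_ge) auto
  have "Poly_Mapping.lookup (\<Sum>d\<le>?D. hcomp d f) u = Poly_Mapping.lookup f u" for u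
    using le[of u] by (cases "u \<in> Poly_Mapping.keys f")
      (auto simp: Poly_Mapping.lookup_sum lookup_hcomp in_keys_iff simp del: Max_insert)
  then show ?thesis
    by (metis poly_mapping_eqI)
qed

section \<open>The substitution action as a ring endomorphism\<close>

definition lin_image :: "nat \<Rightarrow> 'a :: field mat \<Rightarrow> nat \<Rightarrow> 'a mpol" where
  "lin_image n g k = (\<Sum>i=1..n. const_pol (g $$ (i - 1, k - 1)) * pvar i)"

definition act_mon :: "nat \<Rightarrow> 'a :: field mat \<Rightarrow> (nat \<Rightarrow>\<^sub>0 nat) \<Rightarrow> 'a mpol" where
  "act_mon n g u = (\<Prod>k=1..n. lin_image n g k ^ Poly_Mapping.lookup u k)"

text \<open>The supports of \<open>f\<close>, \<open>h\<close> and \<open>f + h\<close> may differ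
  through cancellation; over one common finite index set additivity can be checked term by
  term.\<close>

lemma act_superset:
  assumes "finite K" "Poly_Mapping.keys f \<subseteq> K"
  shows "act n g f = (\<Sum>u\<in>K. const_pol (Poly_Mapping.lookup f u) * act_mon n g u)"
  unfolding act_def act_mon_def lin_image_def using assms
  by (intro sum.mono_neutral_left) (auto simp: in_keys_iff)

lemma act_add: "act n g (f + h) = act n g f + act n g h"
proof -
  let ?K = "Poly_Mapping.keys f \<union> Poly_Mapping.keys h"
  show ?thesis
    using Poly_Mapping.keys_add[of f h]
    by (simp add: act_superset[of ?K] Poly_Mapping.lookup_add const_pol_add algebra_simps sum.distrib)
qed

lemma act_single: "act n g (Poly_Mapping.single u c) = const_pol c * act_mon n g u"
  using act_superset[of "{u}" "Poly_Mapping.single u c" n g] by simp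

lemma act_0 [simp]: "act n g 0 = 0"
  by (simp add: act_def)

lemma act_const [simp]: "act n g (const_pol c) = const_pol c"
  unfolding const_pol_def[of c] act_single by (simp add: act_mon_def const_pol_def)

lemma act_1 [simp]: "act n g 1 = 1"
  using act_const[of n g 1] by simp

lemma act_mult_single:
  "act n g (Poly_Mapping.single u c * f) = act n g (Poly_Mapping.single u c) * act n g f"
proof (induction f rule: mpol_induct)
  case (add f v d)
  have "act n g (Poly_Mapping.single u c * Poly_Mapping.single v d)
     = act n g (Poly_Mapping.single u c) * act n g (Poly_Mapping.single v d)"
    by (simp add: Poly_Mapping.mult_single act_single act_mon_def Poly_Mapping.lookup_add power_add
        prod.distrib const_pol_mult algebra_simps)
  with add show ?case
    by (simp add: act_add distrib_left)
qed auto

lemma act_mult: "act n g (f * h) = act n g f * act n g h"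
  by (induction f rule: mpol_induct)
    (auto simp: act_add distrib_right act_mult_single)

lemma act_comm_ring_hom: "comm_ring_hom (act n g)"
  by standard (auto simp: act_add act_mult)

lemma act_pvar:
  assumes "k \<in> {1..n}"
  shows "act n g (pvar k) = lin_image n g k"
proof -
  have "act n g (pvar k) = act_mon n g (Poly_Mapping.single k 1)"
    unfolding pvar_def act_single by simp
  also have "\<dots> = (\<Prod>j=1..n. if k = j then lin_image n g j else 1)"
    unfolding act_mon_def by (rule prod.cong) (auto simp: Poly_Mapping.lookup_single when_def)
  finally show ?thesis
    using assms by simp
qed

hide_const (open) up_ring.coeff up_ring.monom Poly_Mapping.degree

section \<open>The coinvariant ideal and Vieta relations\<close>

lemma ideal_coinv: "ideal (coinv_ideal n G) (poly_ring n)"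
proof -
  interpret cring "poly_ring n" by (rule cring_poly_ring)
  show ?thesis
    unfolding coinv_ideal_def by (rule genideal_ideal) (auto simp: invariants_def)
qed

lemma coinv_0 [simp]: "0 \<in> coinv_ideal n G"
  using additive_subgroup.zero_closed[OF ideal.axioms(1)[OF ideal_coinv[of n G]]]
  by (simp add: poly_ring_simps)

lemma coinv_add: "f \<in> coinv_ideal n G \<Longrightarrow> g \<in> coinv_ideal n G \<Longrightarrow> f + g \<in> coinv_ideal n G"
  using additive_subgroup.a_closed[OF ideal.axioms(1)[OF ideal_coinv[of n G]]]
  by (simp add: poly_ring_simps)

lemma coinv_mult: "f \<in> coinv_ideal n G \<Longrightarrow> h \<in> polys {1..n} \<Longrightarrow> h * f \<in> coinv_ideal n G"
  using ideal.I_l_closed[OF ideal_coinv[of n G], of f h]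
  by (simp add: poly_ring_simps carrier_poly_ring)

lemma coinv_uminus: "f \<in> coinv_ideal n G \<Longrightarrow> - f \<in> coinv_ideal n G"
  using coinv_mult[of f n G "- 1"] by (simp add: polys_uminus)

lemma coinv_gen:
  "f \<in> invariants n G \<Longrightarrow> homogeneous d f \<Longrightarrow> d > 0 \<Longrightarrow> f \<in> coinv_ideal n G"
proof -
  interpret cring "poly_ring n :: 'a mpol ring" by (rule cring_poly_ring)
  show "f \<in> invariants n G \<Longrightarrow> homogeneous d f \<Longrightarrow> d > 0 \<Longrightarrow> f \<in> coinv_ideal n G"
    unfolding coinv_ideal_def by (rule genideal_self[THEN subsetD]) (auto simp: invariants_def)
qed

text \<open>Horner's scheme only adds and multiplies by \<open>s\<close>. The closure conditions are
  weak enough to cover both the subring \<open>polys T\<close> and the coinvariant ideal.\<close>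

lemma synthetic_div_in:
  fixes p :: "'a :: comm_ring_1 poly"
  assumes A: "0 \<in> A" "\<And>a b. a \<in> A \<Longrightarrow> b \<in> A \<Longrightarrow> a + b \<in> A" "\<And>a. a \<in> A \<Longrightarrow> s * a \<in> A"
    and "\<And>i. coeff p i \<in> A"
  shows "poly p s \<in> A \<and> (\<forall>i. coeff (synthetic_div p s) i \<in> A)"
  using assms(4)
proof (induction p)
  case (pCons a p)
  have "a \<in> A" "\<And>i. coeff p i \<in> A"
    using pCons.prems[of 0] pCons.prems[of "Suc i" for i] by auto
  with pCons.IH show ?case
    using A by (auto simp: coeff_pCons split: nat.split)
qed (use A in simp)

text \<open>Lets a sum that is divisible by X - c be divided summand by summand, although the
  summands themselves leave remainders.\<close>

lemma synthetic_div_add: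
  "synthetic_div (p + q) c = synthetic_div p c + synthetic_div q (c :: 'a :: comm_ring_1)"
proof -
  have "(p + q) + Polynomial.smult c (synthetic_div p c + synthetic_div q c)
      = pCons (poly p c + poly q c) (synthetic_div p c + synthetic_div q c)"
    using synthetic_div_correct[of p c] synthetic_div_correct[of q c]
    by (metis (no_types, lifting) add.assoc add.commute add_pCons smult_add_right)
  from synthetic_div_unique[OF this] show ?thesis by simp
qed

lemma synthetic_div_linear_mult: "synthetic_div ([:- c, 1:] * r) c = (r :: 'a :: comm_ring_1 poly)"
proof -
  have "[:- c, 1:] * r + Polynomial.smult c r = pCons 0 r"
    by simp
  from synthetic_div_unique[OF this] show ?thesis by simp
qed

text \<open>Keeps the quotient monic when the dividend is monic.\<close>

lemma coeff_synthetic_div_degree: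
  fixes q :: "'a :: comm_ring_1 poly"
  assumes "degree q = Suc d"
  shows "coeff (synthetic_div q s) d = coeff q (Suc d)"
proof -
  have "coeff (synthetic_div q s) (Suc d) = 0"
    by (rule coeff_eq_0) (simp add: degree_synthetic_div assms)
  with arg_cong[OF synthetic_div_correct[of q s], of "\<lambda>p. coeff p (Suc d)"] show ?thesis
    by simp
qed

lemma coeff_linear_mult:
  "coeff ([:- w, 1:] * Q) k = - w * coeff Q k + (case k of 0 \<Rightarrow> 0 | Suc k \<Rightarrow> coeff Q k)"
  for Q :: "'a :: comm_ring_1 poly"
  by (simp add: coeff_pCons split: nat.split)

text \<open>Up to sign, coefficient \<open>k\<close> is the elementary symmetric function of degree
  \<open>card A - k\<close> in linear forms. The vanishing beyond \<open>card A\<close> is carried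
  along because the recursion for the enlarged set looks at coefficient \<open>card A + 1\<close> of
  the smaller product.\<close>

lemma homogeneous_coeff_prod:
  fixes A :: "'a :: comm_ring_1 mpol set"
  assumes "finite A" "\<And>w. w \<in> A \<Longrightarrow> homogeneous 1 w"
  shows "if k \<le> card A then homogeneous (card A - k) (coeff (\<Prod>w\<in>A. [:- w, 1:]) k)
    else coeff (\<Prod>w\<in>A. [:- w, 1:]) k = 0"
  using assms
proof (induction A arbitrary: k rule: finite_induct)
  case empty
  then show ?case
    using homogeneous_const[of "1 :: 'a"] by (simp add: coeff_pCons split: nat.split)
next
  case (insert w A)
  let ?Q = "\<Prod>w\<in>A. [:- w, 1:]"
  have IH: "if k \<le> card A then homogeneous (card A - k) (coeff ?Q k) else coeff ?Q k = 0" for k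
    using insert by blast
  have c: "coeff (\<Prod>w\<in>insert w A. [:- w, 1:]) k
      = - w * coeff ?Q k + (case k of 0 \<Rightarrow> 0 | Suc k \<Rightarrow> coeff ?Q k)"
    by (simp only: prod.insert[OF insert.hyps(1,2)] coeff_linear_mult)
  have 1: "homogeneous (Suc (card A) - k) (- w * coeff ?Q k)" if "k \<le> Suc (card A)"
  proof (cases "k \<le> card A")
    case True
    then have "homogeneous (1 + (card A - k)) (- w * coeff ?Q k)"
      using IH[of k] insert.prems[of w] by (intro homogeneous_mult homogeneous_uminus) auto
    with True show ?thesis by (simp add: Suc_diff_le)
  qed (use IH[of k] in auto)
  have 2: "homogeneous (Suc (card A) - k) (case k of 0 \<Rightarrow> 0 | Suc k \<Rightarrow> coeff ?Q k)"
    if "k \<le> Suc (card A)"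
    using that IH[of "k - 1"] by (auto split: nat.split)
  show ?case
  proof (cases "k \<le> Suc (card A)")
    case True
    then show ?thesis
      unfolding c using homogeneous_add[OF 1[OF True] 2[OF True]] insert.hyps by simp
  next
    case False
    then show ?thesis
      unfolding c using IH[of k] IH[of "k - 1"] False insert.hyps by (auto split: nat.split if_splits)
  qed
qed

text \<open>Applying \<open>g\<close> to all coefficients merely permutes the linear factors.
  Injectivity on the finite set comes from its image being the set itself.\<close>

lemma act_map_poly_prod:
  assumes "act n g ` \<Omega> = \<Omega>" "finite \<Omega>"
  shows "act n g (coeff (\<Prod>w\<in>\<Omega>. [:- w, 1:]) k) = coeff (\<Prod>w\<in>\<Omega>. [:- w, 1:]) k"
proof -
  interpret comm_ring_hom "act n g" by (rule act_comm_ring_hom)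
  interpret mp: map_poly_comm_ring_hom "act n g" ..
  have inj: "inj_on (act n g) \<Omega>"
    using assms by (simp add: eq_card_imp_inj_on)
  have "map_poly (act n g) (\<Prod>w\<in>\<Omega>. [:- w, 1:]) = (\<Prod>w\<in>\<Omega>. [:- act n g w, 1:])"
    by (simp add: mp.hom_prod hom_uminus)
  also have "\<dots> = (\<Prod>w\<in>act n g ` \<Omega>. [:- w, 1:])"
    using inj by (simp add: prod.reindex)
  also have "\<dots> = (\<Prod>w\<in>\<Omega>. [:- w, 1:])"
    by (simp add: assms)
  finally have "coeff (map_poly (act n g) (\<Prod>w\<in>\<Omega>. [:- w, 1:])) k = coeff (\<Prod>w\<in>\<Omega>. [:- w, 1:]) k"
    by simp
  then show ?thesis
    by (simp only: coeff_map_poly[of "act n g", OF act_0])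
qed

text \<open>
  Modulo the coinvariant ideal, \<open>\<Prod>\<^bsub>w\<in>\<Omega>\<^esub> (X - w)\<close> is \<open>X ^ card \<Omega>\<close>. Dividing both sides
  successively by \<open>X - s\<close> for the \<open>s \<in> \<Omega>\<close> that only involve the variables in \<open>T\<close> leaves a monic
  polynomial with coefficients in these variables that vanishes at the remaining elements of \<open>\<Omega>\<close>.
\<close>

lemma orbit_relation:
  fixes \<Omega> :: "'a :: field mpol set"
  assumes fin: "finite \<Omega>" and \<Omega>: "\<Omega> \<subseteq> polys {1..n}" and hom: "\<And>w. w \<in> \<Omega> \<Longrightarrow> homogeneous 1 w"
    and stable: "\<And>g. g \<in> G \<Longrightarrow> act n g ` \<Omega> = \<Omega>"
    and z: "z \<in> \<Omega>" "z \<notin> polys T" and T: "T \<subseteq> {1..n}"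
  defines "e \<equiv> card \<Omega> - card (\<Omega> \<inter> polys T)"
  shows "\<exists>c. (\<forall>i. c i \<in> polys T) \<and> z ^ e + (\<Sum>i<e. c i * z ^ i) \<in> coinv_ideal n G"
proof -
  let ?J = "coinv_ideal n G"
  let ?E = "\<lambda>A. \<Prod>w\<in>A. [:- w, 1:]"
  have E_in: "coeff (?E \<Omega>) k \<in> polys {1..n}" for k
  proof -
    have "\<forall>k. coeff (?E A) k \<in> polys {1..n}" if "A \<subseteq> \<Omega>" "finite A" for A
      using that(2,1)
    proof (induction A rule: finite_induct)
      case (insert w A)
      then have "w \<in> polys {1..n}" "\<forall>k. coeff (?E A) k \<in> polys {1..n}"
        using \<Omega> by auto
      then have "\<forall>k. coeff ([:- w, 1:] * ?E A) k \<in> polys {1..n}"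
        unfolding coeff_linear_mult
        by (intro allI polys_add polys_mult polys_uminus) (auto split: nat.split)
      then show ?case
        unfolding prod.insert[OF insert.hyps(1,2)] .
    qed (auto simp: coeff_pCons split: nat.split)
    then show ?thesis using fin by blast
  qed
  \<comment> \<open>Below the top, each coefficient is an invariant form of degree
    \<open>card \<Omega> - k > 0\<close>; the top coefficient is 1 and cancels against the
    monomial.\<close>
  have E_J: "coeff (?E \<Omega> - monom 1 (card \<Omega>)) k \<in> ?J" for k
  proof (cases "k < card \<Omega>")
    case True
    have "homogeneous (card \<Omega> - k) (coeff (?E \<Omega>) k)"
      using homogeneous_coeff_prod[OF fin hom, of k] True by simp
    then have "coeff (?E \<Omega>) k \<in> ?J"
      using True E_in stable fin
      by (intro coinv_gen[where d = "card \<Omega> - k"])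
        (auto simp: invariants_def carrier_poly_ring act_map_poly_prod)
    then show ?thesis using True by simp
  next
    case False
    have "coeff (?E \<Omega>) (card \<Omega>) = 1"
    proof -
      have "degree (?E \<Omega>) = card \<Omega>"
        by (subst degree_prod_eq_sum_degree) auto
      moreover have "lead_coeff (?E \<Omega>) = 1"
        by (simp add: lead_coeff_prod)
      ultimately show ?thesis by simp
    qed
    then show ?thesis
      using homogeneous_coeff_prod[OF fin hom, of k] False by (cases "k = card \<Omega>") auto
  qed
  \<comment> \<open>Degree and leading coefficient are tracked for \<open>q\<close> only. Of
    \<open>r\<close> it is enough to know that its coefficients lie in the ideal, because it will
    only be evaluated.\<close>
  have "\<exists>q r. ?E (\<Omega> - S) = q + r \<and> (\<forall>i. coeff q i \<in> polys T) \<and> (\<forall>i. coeff r i \<in> ?J) \<and>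
      degree q = card \<Omega> - card S \<and> coeff q (card \<Omega> - card S) = 1"
    if "finite S" "S \<subseteq> \<Omega> \<inter> polys T" for S
    using that
  proof (induction S rule: finite_induct)
    case empty
    show ?case
      by (rule exI[of _ "monom 1 (card \<Omega>)"], rule exI[of _ "?E \<Omega> - monom 1 (card \<Omega>)"])
        (use E_J in \<open>auto simp: degree_monom_eq\<close>)
  next
    case (insert s S)
    then obtain q r where qr: "?E (\<Omega> - S) = q + r" "\<forall>i. coeff q i \<in> polys T" "\<forall>i. coeff r i \<in> ?J"
      "degree q = card \<Omega> - card S" "coeff q (card \<Omega> - card S) = 1"
      by auto
    have s: "s \<in> \<Omega> - S" "s \<in> polys T" using insert by auto
    have "card S < card \<Omega>"
      using s insert.prems fin by (intro psubset_card_mono) auto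
    then obtain d where d: "card \<Omega> - card S = Suc d" "card \<Omega> - card (insert s S) = d"
      using insert.hyps by (cases "card \<Omega> - card S") auto
    have "?E (\<Omega> - S) = [:- s, 1:] * ?E (\<Omega> - insert s S)"
      unfolding Diff_insert[of \<Omega> s S] using s fin by (intro prod.remove) auto
    then have "synthetic_div (q + r) s = ?E (\<Omega> - insert s S)"
      by (simp only: qr(1) synthetic_div_linear_mult)
    then have "?E (\<Omega> - insert s S) = synthetic_div q s + synthetic_div r s"
      by (simp only: synthetic_div_add)
    moreover have "\<forall>i. coeff (synthetic_div q s) i \<in> polys T"
      using synthetic_div_in[of "polys T" s q] qr(2) s by auto
    moreover have "\<forall>i. coeff (synthetic_div r s) i \<in> ?J"
      using synthetic_div_in[of ?J s r] qr(3) s \<Omega> by (auto simp: coinv_add coinv_mult)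
    moreover have "degree (synthetic_div q s) = d"
      using qr d by (simp add: degree_synthetic_div)
    moreover have "coeff (synthetic_div q s) d = 1"
      using qr d by (simp add: coeff_synthetic_div_degree)
    ultimately show ?case
      unfolding d by blast
  qed
  from this[of "\<Omega> \<inter> polys T"] obtain q r where qr: "?E (\<Omega> - \<Omega> \<inter> polys T) = q + r"
    "\<forall>i. coeff q i \<in> polys T" "\<forall>i. coeff r i \<in> ?J" "degree q = e" "coeff q e = 1"
    using fin unfolding e_def by blast
  \<comment> \<open>Since \<open>z\<close> lies outside \<open>polys T\<close>, its factor has
    survived all the divisions.\<close>
  have "poly (?E (\<Omega> - \<Omega> \<inter> polys T)) z = 0"
    using z fin by (auto simp: poly_prod)
  then have "poly q z = - poly r z"
    unfolding qr(1) by (simp add: eq_neg_iff_add_eq_0)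
  moreover have "poly r z \<in> ?J"
    using synthetic_div_in[of ?J z r] qr(3) z \<Omega> by (auto simp: coinv_add coinv_mult)
  ultimately have "poly q z \<in> ?J"
    by (simp add: coinv_uminus)
  moreover have "poly q z = z ^ e + (\<Sum>i<e. coeff q i * z ^ i)"
    using qr(4,5) by (simp add: poly_altdef flip: lessThan_Suc_atMost)
  ultimately show ?thesis
    using qr(2) by auto
qed

section \<open>Triangular reduction\<close>

text \<open>Congruence modulo \<open>J\<close> to a linear combination of monomials with exponents
  in \<open>K\<close>. The inductive form keeps coefficients and index sets out of the reduction
  argument; \<open>red_coefficients\<close> recovers them afterwards.\<close>

inductive_set red :: "'a :: comm_ring_1 mpol set \<Rightarrow> (nat \<Rightarrow>\<^sub>0 nat) set \<Rightarrow> 'a mpol set"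
  for J K where
  ideal: "f \<in> J \<Longrightarrow> f \<in> red J K"
| single: "u \<in> K \<Longrightarrow> Poly_Mapping.single u c \<in> red J K"
| add: "f \<in> red J K \<Longrightarrow> g \<in> red J K \<Longrightarrow> f + g \<in> red J K"

lemma red_sum:
  "0 \<in> J \<Longrightarrow> (\<And>i. i \<in> A \<Longrightarrow> f i \<in> red J K) \<Longrightarrow> (\<Sum>i\<in>A. f i) \<in> red J K"
  by (induction A rule: infinite_finite_induct) (auto intro: red.intros)

lemma red_coefficients:
  assumes "f \<in> red (coinv_ideal n G) K" "finite K"
  shows "\<exists>a. f - (\<Sum>u\<in>K. Poly_Mapping.single u (a u)) \<in> coinv_ideal n G"
  using assms(1)
proof (induction rule: red.induct)
  case (ideal f)
  then show ?case by (intro exI[of _ "\<lambda>_. 0"]) simp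
next
  case (single u c)
  then show ?case
    using assms(2) by (intro exI[of _ "\<lambda>v. if v = u then c else 0"]) (simp add: if_distrib cong: if_cong)
next
  case (add f g)
  then obtain a b where "f - (\<Sum>u\<in>K. Poly_Mapping.single u (a u)) \<in> coinv_ideal n G"
    "g - (\<Sum>u\<in>K. Poly_Mapping.single u (b u)) \<in> coinv_ideal n G" by blast
  from coinv_add[OF this] show ?case
    by (intro exI[of _ "\<lambda>u. a u + b u"]) (simp add: Poly_Mapping.single_add sum.distrib algebra_simps)
qed

text \<open>Used to drop a redundant monomial from a spanning set.\<close>

lemma red_trans:
  assumes "f \<in> red J K" "\<And>u c. u \<in> K \<Longrightarrow> Poly_Mapping.single u c \<in> red J K'"
  shows "f \<in> red J K'"
  using assms(1) by (induction rule: red.induct) (auto intro: red.intros assms(2))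

definition box :: "(nat \<Rightarrow> nat) \<Rightarrow> nat set \<Rightarrow> (nat \<Rightarrow>\<^sub>0 nat) set" where
  "box e T = {u. Poly_Mapping.keys u \<subseteq> T \<and> (\<forall>k\<in>T. Poly_Mapping.lookup u k < e k)}"

lemma box_insert:
  assumes "u \<in> box e T" "x \<notin> T" "N < e x"
  shows "u + Poly_Mapping.single x N \<in> box e (insert x T)"
proof -
  have "Poly_Mapping.lookup u x = 0"
    using assms by (auto simp: box_def in_keys_iff)
  moreover have "Poly_Mapping.keys (u + Poly_Mapping.single x N) \<subseteq> insert x T"
    using Poly_Mapping.keys_add[of u "Poly_Mapping.single x N"] assms(1)
    by (fastforce simp: box_def split: if_splits)
  ultimately show ?thesis
    using assms by (auto simp: box_def Poly_Mapping.lookup_add Poly_Mapping.lookup_single when_def)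
qed

text \<open>Outer induction eliminates the variables in list order, inner induction lowers the
  exponent of the current variable. The relation for \<open>x\<close> has coefficients in later
  variables only, so lowering the exponent of \<open>x\<close> leaves coefficients to which the
  outer hypothesis applies, and reducing these never brings \<open>x\<close> back.\<close>

lemma triangular_reduction:
  fixes e :: "nat \<Rightarrow> nat" and G :: "'a :: field mat set" and n :: nat
  defines "J \<equiv> coinv_ideal n G"
  assumes "distinct xs" "set xs \<subseteq> {1..n}"
    and "\<And>ys x zs. xs = ys @ x # zs \<Longrightarrow>
      \<exists>c. (\<forall>i. c i \<in> polys (set zs)) \<and> pvar x ^ e x + (\<Sum>i<e x. c i * pvar x ^ i) \<in> J"
    and "f \<in> polys (set xs)"
  shows "f \<in> red J (box e (set xs))"
  using assms(2-)
proof (induction xs arbitrary: f)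
  case Nil
  have "Poly_Mapping.keys f \<subseteq> {u. Poly_Mapping.keys u \<subseteq> {}}"
    using Nil.prems(4) unfolding polys_def list.set by blast
  then show ?case
    by (induction f rule: mpol_induct_on)
      (auto simp: box_def J_def intro!: red.add intro: red.ideal red.single)
next
  case (Cons x xs)
  let ?T = "set xs"
  have x: "x \<notin> ?T" "x \<in> {1..n}" and T: "polys ?T \<subseteq> (polys {1..n} :: 'a mpol set)"
    using Cons.prems by (auto intro!: polys_mono)
  have IH: "f \<in> red J (box e ?T)" if "f \<in> polys ?T" for f
  proof (rule Cons.IH)
    fix ys z zs assume "xs = ys @ z # zs"
    then show "\<exists>c. (\<forall>i. c i \<in> polys (set zs)) \<and> pvar z ^ e z + (\<Sum>i<e z. c i * pvar z ^ i) \<in> J"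
      by (intro Cons.prems(3)[of "x # ys"]) simp
  qed (use Cons.prems that in auto)
  from Cons.prems(3)[of "[]" x xs] obtain c where
    c: "\<And>i. c i \<in> polys ?T" "pvar x ^ e x + (\<Sum>i<e x. c i * pvar x ^ i) \<in> J"
    by auto
  \<comment> \<open>The coefficient \<open>b\<close> stays arbitrary, as each use of the relation
    replaces it by the products \<open>- b * c i\<close>.\<close>
  have power: "b * pvar x ^ N \<in> red J (box e (insert x ?T))" if "b \<in> polys ?T" for b N
    using that
  proof (induction N arbitrary: b rule: less_induct)
    case (less N)
    show ?case
    proof (cases "N < e x")
      case True
      \<comment> \<open>The exponent of \<open>x\<close> is already small enough: reduce
        \<open>b\<close> in the later variables and multiply the result by the power of
        \<open>x\<close>.\<close>
      from IH[OF less.prems] show ?thesis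
      proof (induction rule: red.induct)
        case (ideal f)
        then have "pvar x ^ N * f \<in> J"
          unfolding J_def by (intro coinv_mult polys_power polys_pvar x(2))
        then show ?case
          by (auto simp: mult.commute intro: red.ideal)
      next
        case (single u a)
        have "Poly_Mapping.single u a * pvar x ^ N = Poly_Mapping.single (u + Poly_Mapping.single x N) a"
          by (simp add: Poly_Mapping.mult_single flip: mon_pvar_power)
        then show ?case
          using box_insert[OF single x(1) True] by (auto intro: red.single)
      qed (auto simp: distrib_right intro: red.add)
    next
      case False
      let ?r = "pvar x ^ e x + (\<Sum>i<e x. c i * pvar x ^ i)"
      \<comment> \<open>Subtracting a multiple of the relation trades exponent \<open>N\<close> for
        the exponents \<open>N - e x + i\<close> with \<open>i < e x\<close>, all of them below
        \<open>N\<close>.\<close>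
      have N: "b * pvar x ^ N = (b * pvar x ^ (N - e x)) * ?r
          + (\<Sum>i<e x. (- b * c i) * pvar x ^ (N - e x + i))"
        using False by (simp add: distrib_left sum_distrib_left power_add[symmetric] mult.assoc
            sum_negf mult.left_commute power_add)
      have "(b * pvar x ^ (N - e x)) * ?r \<in> J"
        using c(2) less.prems x T unfolding J_def
        by (intro coinv_mult) (auto intro!: polys_mult polys_power)
      moreover have "(- b * c i) * pvar x ^ (N - e x + i) \<in> red J (box e (insert x ?T))" if "i < e x" for i
        using that False less.prems c(1) by (intro less.IH) (auto intro!: polys_mult polys_uminus)
      ultimately show ?thesis
        unfolding N by (intro red.add red_sum) (auto intro: red.ideal simp: J_def)
    qed
  qed
  have "Poly_Mapping.keys f \<subseteq> {u. Poly_Mapping.keys u \<subseteq> insert x ?T}"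
    using Cons.prems(4) by (auto simp: polys_def)
  then have "f \<in> red J (box e (insert x ?T))"
  proof (induction f rule: mpol_induct_on)
    case zero
    then show ?case by (auto simp: J_def intro: red.ideal)
  next
    case (add f u a)
    \<comment> \<open>The part of the exponent vector that belongs to the later variables.\<close>
    define v where "v = u - Poly_Mapping.single x (Poly_Mapping.lookup u x)"
    have u: "u = v + Poly_Mapping.single x (Poly_Mapping.lookup u x)"
      by (rule poly_mapping_eqI)
        (simp add: v_def Poly_Mapping.lookup_add Poly_Mapping.lookup_minus Poly_Mapping.lookup_single when_def)
    have "Poly_Mapping.keys v \<subseteq> Poly_Mapping.keys u - {x}"
      by (auto simp: v_def in_keys_iff Poly_Mapping.lookup_minus
          Poly_Mapping.lookup_single when_def split: if_splits)
    then have "Poly_Mapping.keys v \<subseteq> ?T"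
      using add(1) by auto
    then have "Poly_Mapping.single v a * pvar x ^ Poly_Mapping.lookup u x \<in> red J (box e (insert x ?T))"
      by (intro power polys_mon)
    also have "Poly_Mapping.single v a * pvar x ^ Poly_Mapping.lookup u x = Poly_Mapping.single u a"
      by (subst (2) u) (simp add: Poly_Mapping.mult_single flip: mon_pvar_power)
    finally show ?case
      using add(2) by (rule red.add)
  qed
  then show ?case by simp
qed

section \<open>The lower bound for spanning sets\<close>

lemma invariants_0: "0 \<in> invariants n G"
  and invariants_const: "const_pol c \<in> invariants n G"
  and invariants_add: "f \<in> invariants n G \<Longrightarrow> h \<in> invariants n G \<Longrightarrow> f + h \<in> invariants n G"
  and invariants_mult: "f \<in> invariants n G \<Longrightarrow> h \<in> invariants n G \<Longrightarrow> f * h \<in> invariants n G"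
  by (auto simp: invariants_def carrier_poly_ring act_add act_mult)

text \<open>
  Graded Nakayama lemma. In degree \<open>d\<close>, the polynomials all of whose multiples have their component of
  degree \<open>d\<close> in the span \<open>M\<close> form an ideal. By induction on \<open>d\<close> it contains the homogeneous
  invariants of positive degree, hence all of the coinvariant ideal.
\<close>

lemma span_over_invariants:
  fixes f :: "'a :: field mpol"
  assumes K: "finite K" "\<And>u. u \<in> K \<Longrightarrow> Poly_Mapping.keys u \<subseteq> {1..n}"
    and span: "polys {1..n} \<subseteq> red (coinv_ideal n G) K" and f: "f \<in> polys {1..n}"
  shows "\<exists>h. (\<forall>u\<in>K. h u \<in> invariants n G) \<and> f = (\<Sum>u\<in>K. h u * mon u)"
proof -
  define M :: "'a mpol set"
    where "M = {\<Sum>u\<in>K. h u * mon u | h. \<forall>u\<in>K. h u \<in> invariants n G}"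
  have M_add: "a + b \<in> M" if ab: "a \<in> M" "b \<in> M" for a b
  proof -
    obtain h h' where "\<forall>u\<in>K. h u \<in> invariants n G" "a = (\<Sum>u\<in>K. h u * mon u)"
      "\<forall>u\<in>K. h' u \<in> invariants n G" "b = (\<Sum>u\<in>K. h' u * mon u)"
      using ab unfolding M_def by auto
    then show ?thesis
      unfolding M_def by (auto simp: distrib_right sum.distrib intro!: exI[of _ "\<lambda>u. h u + h' u"] invariants_add)
  qed
  have M_mult: "s * a \<in> M" if "s \<in> invariants n G" and a: "a \<in> M" for a s
  proof -
    obtain h where "\<forall>u\<in>K. h u \<in> invariants n G" "a = (\<Sum>u\<in>K. h u * mon u)"
      using a unfolding M_def by auto
    with that(1) show ?thesis
      unfolding M_def by (auto simp: sum_distrib_left mult.assoc intro!: exI[of _ "\<lambda>u. s * h u"] invariants_mult)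
  qed
  have M_0: "0 \<in> M"
    unfolding M_def by (auto intro!: exI[of _ "\<lambda>_. 0"] invariants_0)
  have M_single: "Poly_Mapping.single u c \<in> M" if "u \<in> K" for u c
    unfolding M_def using that K(1)
    by (auto intro!: exI[of _ "\<lambda>v. if v = u then const_pol c else 0"] invariants_const invariants_0
        simp: single_eq[of u c] if_distrib[of "\<lambda>x. x * y" for y] cong: if_cong)
  have M_sum: "(\<Sum>i\<in>A. t i) \<in> M" if "\<And>i. i \<in> A \<Longrightarrow> t i \<in> M" for A :: "'i set" and t
    using that by (induction A rule: infinite_finite_induct) (auto simp: M_add M_0)
  have M_uminus: "- a \<in> M" if "a \<in> M" for a
    using M_mult[OF invariants_const[of "- 1"] that] by (simp add: const_pol_uminus)
  have hom: "hcomp d f \<in> M" if "f \<in> polys {1..n}" for d f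
    using that
  proof (induction d arbitrary: f rule: less_induct)
    case (less d)
    define Z where "Z = {t \<in> polys {1..n}. \<forall>r\<in>polys {1..n}. hcomp d (r * t) \<in> M}"
    interpret R: cring "poly_ring n :: 'a mpol ring" by (rule cring_poly_ring)
    have "ideal Z (poly_ring n)"
    proof (rule idealI)
      show "subgroup Z (add_monoid (poly_ring n))"
      proof (rule R.add.subgroupI)
        show "Z \<subseteq> carrier (poly_ring n)" by (auto simp: Z_def carrier_poly_ring)
        have "0 \<in> Z" by (simp add: Z_def M_0)
        then show "Z \<noteq> {}" by blast
        show "a \<oplus>\<^bsub>poly_ring n\<^esub> b \<in> Z" if "a \<in> Z" "b \<in> Z" for a b
          using that by (auto simp: Z_def poly_ring_simps distrib_left hcomp_add M_add)
        show "\<ominus>\<^bsub>poly_ring n\<^esub> a \<in> Z" if "a \<in> Z" for a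
        proof -
          have a: "a \<in> polys {1..n}" using that by (simp add: Z_def)
          then have "\<ominus>\<^bsub>poly_ring n\<^esub> a = - a"
            by (intro R.minus_equality) (auto simp: poly_ring_simps carrier_poly_ring)
          moreover have "hcomp d (r * - a) \<in> M" if "r \<in> polys {1..n}" for r
            using \<open>a \<in> Z\<close> polys_uminus[OF that] by (force simp: Z_def)
          ultimately show ?thesis
            using a by (auto simp: Z_def)
        qed
      qed
      show "x \<otimes>\<^bsub>poly_ring n\<^esub> a \<in> Z" if "a \<in> Z" "x \<in> carrier (poly_ring n)" for a x
        using that by (auto simp: Z_def poly_ring_simps carrier_poly_ring simp flip: mult.assoc)
      then show "a \<otimes>\<^bsub>poly_ring n\<^esub> x \<in> Z" if "a \<in> Z" "x \<in> carrier (poly_ring n)" for a x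
        using that by (auto simp: poly_ring_simps mult.commute)
    qed (rule R.ring_axioms)
    moreover have "{s \<in> invariants n G. \<exists>e>0. homogeneous e s} \<subseteq> Z"
    proof safe
      fix s :: "'a mpol" and e :: nat
      assume s: "s \<in> invariants n G" "0 < e" "homogeneous e s"
      have "hcomp d (r * s) \<in> M" if "r \<in> polys {1..n}" for r
      proof (cases "e \<le> d")
        case True
        then have "hcomp (d - e) r \<in> M"
          using s(2) that by (intro less.IH) auto
        then show ?thesis
          using True M_mult[OF s(1)] by (simp add: hcomp_mult[OF s(3)] mult.commute[of s])
      qed (simp add: hcomp_mult[OF s(3)] M_0)
      then show "s \<in> Z"
        using s(1) by (auto simp: Z_def invariants_def carrier_poly_ring)
    qed
    ultimately have JZ: "coinv_ideal n G \<subseteq> Z"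
      unfolding coinv_ideal_def by (rule R.genideal_minimal)
    obtain a where a: "f - (\<Sum>u\<in>K. Poly_Mapping.single u (a u)) \<in> coinv_ideal n G"
      using red_coefficients[of f n G K] span less.prems K(1) by blast
    let ?s = "\<Sum>u\<in>K. Poly_Mapping.single u (a u)"
    have "f - ?s \<in> Z" using a JZ by blast
    \<comment> \<open>The multiplier 1 in the definition of \<open>Z\<close> yields the statement
      about the polynomial itself.\<close>
    then have "hcomp d (1 * (f - ?s)) \<in> M"
      unfolding Z_def by (blast intro: polys_1)
    then have "hcomp d (f - ?s) + hcomp d ?s \<in> M"
      by (intro M_add) (auto simp: hcomp_sum hcomp_homogeneous[OF homogeneous_single] M_0 M_single intro!: M_sum)
    then show ?case
      by (simp flip: hcomp_add)
  qed
  obtain D where "f = (\<Sum>d\<le>D. hcomp d f)"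
    using sum_hcomp by blast
  moreover have "(\<Sum>d\<le>D. hcomp d f) \<in> M"
    by (intro M_sum hom f)
  ultimately show ?thesis
    unfolding M_def by auto
qed

text \<open>Gaussian elimination free of fractions: cross-multiplication with a pivot replaces
  division, so the solution has its entries in the domain itself.\<close>

lemma homogeneous_system_nontrivial_solution:
  fixes a :: "'i \<Rightarrow> 'j \<Rightarrow> 'r :: idom"
  assumes "finite I" "finite J" "card I < card J"
  shows "\<exists>y. (\<exists>j\<in>J. y j \<noteq> 0) \<and> (\<forall>i\<in>I. (\<Sum>j\<in>J. a i j * y j) = 0)"
  using assms
proof (induction I arbitrary: J a rule: finite_induct)
  case empty
  then have "J \<noteq> {}" by auto
  then show ?case by (intro exI[of _ "\<lambda>_. 1"]) auto
next
  case (insert i I)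
  show ?case
  proof (cases "\<forall>j\<in>J. a i j = 0")
    case True
    with insert.IH[of J a] insert.prems insert.hyps show ?thesis by auto
  next
    case False
    then obtain j0 where j0: "j0 \<in> J" "a i j0 \<noteq> 0" by blast
    let ?J = "J - {j0}"
    have "finite ?J" "card I < card ?J"
      using insert.prems insert.hyps j0 by auto
    from insert.IH[OF this, of "\<lambda>k j. a i j0 * a k j - a k j0 * a i j"] obtain y where
      y: "\<exists>j\<in>?J. y j \<noteq> 0" "\<And>k. k \<in> I \<Longrightarrow> (\<Sum>j\<in>?J. (a i j0 * a k j - a k j0 * a i j) * y j) = 0"
      by blast
    \<comment> \<open>Solves equation \<open>i\<close> for the unknown \<open>j0\<close> after
      scaling the other unknowns by the pivot \<open>a i j0\<close>. For \<open>k = i\<close> the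
      coefficients in the identity below cancel, and a nonzero \<open>y j\<close> stays nonzero
      because there are no zero divisors.\<close>
    define z where "z j = (if j = j0 then - (\<Sum>j\<in>?J. a i j * y j) else a i j0 * y j)" for j
    have z: "(\<Sum>j\<in>J. a k j * z j) = (\<Sum>j\<in>?J. (a i j0 * a k j - a k j0 * a i j) * y j)" for k
    proof -
      have "(\<Sum>j\<in>J. a k j * z j) = a k j0 * z j0 + (\<Sum>j\<in>?J. a k j * z j)"
        using insert.prems j0 by (intro sum.remove) auto
      also have "(\<Sum>j\<in>?J. a k j * z j) = (\<Sum>j\<in>?J. a i j0 * a k j * y j)"
        by (rule sum.cong) (auto simp: z_def)
      finally show ?thesis
        by (simp add: z_def sum_distrib_left left_diff_distrib sum_subtractf mult.assoc)
    qed
    have "(\<Sum>j\<in>J. a k j * z j) = 0" if "k \<in> insert i I" for k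
      using that y(2) unfolding z by auto
    moreover have "\<exists>j\<in>J. z j \<noteq> 0"
      using y(1) j0 by (auto simp: z_def)
    ultimately show ?thesis by blast
  qed
qed

text \<open>Dedekind's argument: the relation at \<open>x * t\<close> minus \<chi>_a(x) times the
  relation at \<open>t\<close> is a relation without the term of \<open>a\<close>. The submonoid
  \<open>M\<close> allows for polynomials in n variables inside a type with countably many.\<close>

lemma characters_independent:
  fixes \<chi> :: "'g \<Rightarrow> 'm :: comm_monoid_mult \<Rightarrow> 'r :: idom"
  assumes "finite A"
    and "1 \<in> M" "\<And>x y. x \<in> M \<Longrightarrow> y \<in> M \<Longrightarrow> x * y \<in> M"
    and "\<And>g. g \<in> A \<Longrightarrow> \<chi> g 1 = 1" "\<And>g x y. g \<in> A \<Longrightarrow> \<chi> g (x * y) = \<chi> g x * \<chi> g y"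
    and "\<And>g h. g \<in> A \<Longrightarrow> h \<in> A \<Longrightarrow> g \<noteq> h \<Longrightarrow> \<exists>x\<in>M. \<chi> g x \<noteq> \<chi> h x"
    and "\<And>x. x \<in> M \<Longrightarrow> (\<Sum>g\<in>A. y g * \<chi> g x) = 0" "g \<in> A"
  shows "y g = 0"
  using assms(1,4-)
proof (induction A arbitrary: y g rule: finite_induct)
  case (insert a A)
  have 0: "y b = 0" if b: "b \<in> A" for b
  proof -
    have "a \<noteq> b" using b insert.hyps by auto
    then obtain x where x: "x \<in> M" "\<chi> a x \<noteq> \<chi> b x"
      using insert.prems(3)[of a b] b by blast
    \<comment> \<open>The new coefficients vanish at \<open>a\<close>, so the induction hypothesis
      applies to them on \<open>A\<close>.\<close>
    have "y b * (\<chi> b x - \<chi> a x) = 0"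
    proof (rule insert.IH[where y = "\<lambda>g. y g * (\<chi> g x - \<chi> a x)", OF _ _ _ _ b])
      fix t assume t: "t \<in> M"
      have "(\<Sum>g\<in>insert a A. y g * \<chi> g (x * t)) - \<chi> a x * (\<Sum>g\<in>insert a A. y g * \<chi> g t) = 0"
        using insert.prems(4) assms(3) x t by simp
      also have "(\<Sum>g\<in>insert a A. y g * \<chi> g (x * t)) - \<chi> a x * (\<Sum>g\<in>insert a A. y g * \<chi> g t)
          = (\<Sum>g\<in>insert a A. y g * (\<chi> g x - \<chi> a x) * \<chi> g t)"
        unfolding sum_distrib_left sum_subtractf[symmetric]
        by (rule sum.cong) (simp_all add: insert.prems(2) algebra_simps)
      finally show "(\<Sum>g\<in>A. y g * (\<chi> g x - \<chi> a x) * \<chi> g t) = 0"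
        using insert.hyps by simp
    qed (use insert.prems in auto)
    with x show ?thesis by simp
  qed
  have "y a * \<chi> a 1 = 0"
    using insert.prems(4)[OF assms(2)] insert.hyps 0 by simp
  with 0 insert.prems show ?case by auto
qed simp

lemma single_1_eq_iff: "Poly_Mapping.single i (Suc 0) = Poly_Mapping.single j (Suc 0) \<longleftrightarrow> i = j"
  by (metis Poly_Mapping.keys_single One_nat_def singleton_inject zero_neq_one)

text \<open>Each \<open>g\<close> is linear over the invariants. A relation between the
  automorphisms that holds on the monomials in \<open>K\<close>, with polynomials \<open>y g\<close>
  as coefficients, therefore holds on all polynomials in the n variables.\<close>

lemma card_group_le_spanning_set:
  fixes G :: "'a :: field mat set"
  assumes K: "finite K" "\<And>u. u \<in> K \<Longrightarrow> Poly_Mapping.keys u \<subseteq> {1..n}"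
    and span: "polys {1..n} \<subseteq> red (coinv_ideal n G) K"
    and G: "finite G" "G \<subseteq> carrier_mat n n"
  shows "card G \<le> card K"
proof (rule ccontr)
  assume "\<not> card G \<le> card K"
  then obtain y where y: "\<exists>g\<in>G. y g \<noteq> 0" "\<And>u. u \<in> K \<Longrightarrow> (\<Sum>g\<in>G. act n g (mon u) * y g) = 0"
    using homogeneous_system_nontrivial_solution[OF K(1) G(1), of "\<lambda>u g. act n g (mon u)"] by auto
  \<comment> \<open>The coefficient of x_i in the image of x_k is a matrix entry, so distinct
    matrices differ on some variable.\<close>
  have sep: "\<exists>x\<in>polys {1..n}. act n g x \<noteq> act n h x" if gh: "g \<in> G" "h \<in> G" "g \<noteq> h" for g h
  proof (rule ccontr)
    assume eq: "\<not> ?thesis"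
    have l: "Poly_Mapping.lookup (lin_image n g k) (Poly_Mapping.single i 1) = g $$ (i - 1, k - 1)"
      if "i \<in> {1..n}" for g :: "'a mat" and i k
      using that by (simp add: single_1_eq_iff lin_image_def Poly_Mapping.lookup_sum const_pol_def pvar_def
          Poly_Mapping.mult_single Poly_Mapping.lookup_single when_def)
    have "g = h"
    proof (rule eq_matI)
      fix i k assume "i < dim_row h" "k < dim_col h"
      then have ik: "Suc i \<in> {1..n}" "Suc k \<in> {1..n}" using gh G(2) by auto
      then have "lin_image n g (Suc k) = lin_image n h (Suc k)"
        using eq polys_pvar[OF ik(2)] by (auto simp flip: act_pvar)
      then show "g $$ (i, k) = h $$ (i, k)"
        using l[OF ik(1), of g "Suc k"] l[OF ik(1), of h "Suc k"] by simp
    qed (use gh G(2) in auto)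
    with gh show False by simp
  qed
  have "y g = 0" if "g \<in> G" for g
  proof (rule characters_independent[OF G(1), where M = "polys {1..n}" and \<chi> = "act n"])
    fix f :: "'a mpol" assume "f \<in> polys {1..n}"
    then obtain h where h: "\<forall>u\<in>K. h u \<in> invariants n G" "f = (\<Sum>u\<in>K. h u * mon u)"
      using span_over_invariants[OF K span] by blast
    have "act n g f = (\<Sum>u\<in>K. h u * act n g (mon u))" if "g \<in> G" for g
    proof -
      interpret comm_ring_hom "act n g" by (rule act_comm_ring_hom)
      show ?thesis
        using that h(1) unfolding h(2)
        by (simp add: hom_sum act_mult) (rule sum.cong, auto simp: invariants_def)
    qed
    then have "(\<Sum>g\<in>G. y g * act n g f) = (\<Sum>g\<in>G. \<Sum>u\<in>K. h u * (act n g (mon u) * y g))"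
      by (intro sum.cong) (auto simp: sum_distrib_left mult_ac)
    also have "\<dots> = (\<Sum>u\<in>K. h u * (\<Sum>g\<in>G. act n g (mon u) * y g))"
      by (subst sum.swap) (simp add: sum_distrib_left)
    also have "\<dots> = 0" using y(2) by simp
    finally show "(\<Sum>g\<in>G. y g * act n g f) = 0" .
  qed (use that sep in \<open>auto simp: act_mult\<close>)
  with y(1) show False by blast
qed

text \<open>A relation with nonzero coefficient at \<open>v\<close> expresses this monomial by the
  others, which would then span with fewer than \<open>card G\<close> elements.\<close>

lemma independent_mod_coinv:
  fixes G :: "'a :: field mat set"
  assumes K: "finite K" "\<And>u. u \<in> K \<Longrightarrow> Poly_Mapping.keys u \<subseteq> {1..n}"
    and span: "polys {1..n} \<subseteq> red (coinv_ideal n G) K"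
    and G: "finite G" "G \<subseteq> carrier_mat n n" and card: "card K \<le> card G"
    and rel: "(\<Sum>u\<in>K. Poly_Mapping.single u (a u)) \<in> coinv_ideal n G" and v: "v \<in> K"
  shows "a v = 0"
proof (rule ccontr)
  assume av: "a v \<noteq> 0"
  let ?J = "coinv_ideal n G" and ?K = "K - {v}"
  have v_red: "Poly_Mapping.single v c \<in> red ?J ?K" for c
  proof -
    let ?b = "c / a v"
    have "const_pol ?b * (\<Sum>u\<in>K. Poly_Mapping.single u (a u)) \<in> ?J"
      by (rule coinv_mult[OF rel]) simp
    moreover have "const_pol ?b * (\<Sum>u\<in>K. Poly_Mapping.single u (a u))
        = Poly_Mapping.single v c + (\<Sum>u\<in>?K. Poly_Mapping.single u (?b * a u))"
      using sum.remove[OF K(1) v, of "\<lambda>u. const_pol ?b * Poly_Mapping.single u (a u)"] av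
      by (simp add: sum_distrib_left const_pol_def Poly_Mapping.mult_single)
    ultimately have "Poly_Mapping.single v c + (\<Sum>u\<in>?K. Poly_Mapping.single u (?b * a u)) \<in> red ?J ?K"
      by (auto intro: red.ideal)
    moreover have "(\<Sum>u\<in>?K. Poly_Mapping.single u (- (?b * a u))) \<in> red ?J ?K"
      by (intro red_sum) (auto intro: red.single)
    ultimately have "(Poly_Mapping.single v c + (\<Sum>u\<in>?K. Poly_Mapping.single u (?b * a u)))
        + (\<Sum>u\<in>?K. Poly_Mapping.single u (- (?b * a u))) \<in> red ?J ?K"
      by (rule red.add)
    then show ?thesis
      by (simp add: Poly_Mapping.single_uminus sum_negf)
  qed
  have "polys {1..n} \<subseteq> red ?J ?K"
  proof
    fix f :: "'a mpol" assume "f \<in> polys {1..n}"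
    then have "f \<in> red ?J K" using span by blast
    then show "f \<in> red ?J ?K"
    proof (rule red_trans)
      fix u and c :: 'a
      assume "u \<in> K"
      then show "Poly_Mapping.single u c \<in> red ?J ?K"
        using v_red by (cases "u = v") (auto intro: red.single)
    qed
  qed
  then have "card G \<le> card ?K"
    using K G by (intro card_group_le_spanning_set) auto
  then show False
    using card v K(1) by (metis card_Diff1_less leD order_trans)
qed

section \<open>Block bases\<close>

lemma finite_box: "finite T \<Longrightarrow> finite (box e T)"
  and card_box_le: "finite T \<Longrightarrow> card (box e T) \<le> (\<Prod>k\<in>T. e k)"
proof -
  assume T: "finite T"
  let ?r = "\<lambda>u. restrict (Poly_Mapping.lookup u) T"
  have fin: "finite (PiE T (\<lambda>k. {..<e k}))"
    using T by (intro finite_PiE) auto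
  have sub: "?r ` box e T \<subseteq> PiE T (\<lambda>k. {..<e k})"
    by (auto simp: box_def)
  have inj: "inj_on ?r (box e T)"
  proof (rule inj_onI)
    fix u v assume uv: "u \<in> box e T" "v \<in> box e T" "?r u = ?r v"
    show "u = v"
    proof (rule poly_mapping_eqI)
      fix k
      show "Poly_Mapping.lookup u k = Poly_Mapping.lookup v k"
      proof (cases "k \<in> T")
        case True
        then show ?thesis using fun_cong[OF uv(3), of k] by simp
      next
        case False
        then have "k \<notin> Poly_Mapping.keys u" "k \<notin> Poly_Mapping.keys v"
          using uv(1,2) unfolding box_def by blast+
        then show ?thesis by (simp add: in_keys_iff)
      qed
    qed
  qed
  show "finite (box e T)"
    using inj_on_finite[OF inj sub fin] .
  show "card (box e T) \<le> (\<Prod>k\<in>T. e k)"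
    using card_inj_on_le[OF inj sub fin] T by (simp add: card_PiE)
qed

text \<open>The support of a product lies in the sum of the supports, so whatever the cofactor,
  \<open>v\<close> is \<open>u\<close> plus an exponent vector. The strict bound in
  \<open>box\<close> accounts for the \<open>+ 1\<close>.\<close>

lemma monomial_factors_mon:
  assumes "Poly_Mapping.keys v \<subseteq> {1..n}"
  shows "monomial_factors n (mon v :: 'a :: comm_ring_1 mpol)
    = mon ` box (\<lambda>k. Poly_Mapping.lookup v k + 1) {1..n}"
proof (intro equalityI subsetI)
  fix q :: "'a mpol" assume "q \<in> monomial_factors n (mon v)"
  then obtain u c where u: "q = mon u" "Poly_Mapping.keys u \<subseteq> {1..n}" "mon v = mon u * (c :: 'a mpol)"
    by (auto simp: monomial_factors_def monomials_def factor_def poly_ring_simps)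
  have "v \<in> Poly_Mapping.keys (mon u * c)"
    unfolding u(3)[symmetric] by simp
  with Poly_Mapping.keys_mult[of "mon u" c] obtain w where "v = u + w"
    by auto
  then show "q \<in> mon ` box (\<lambda>k. Poly_Mapping.lookup v k + 1) {1..n}"
    using u by (auto simp: box_def Poly_Mapping.lookup_add)
next
  fix q :: "'a mpol" assume "q \<in> mon ` box (\<lambda>k. Poly_Mapping.lookup v k + 1) {1..n}"
  then obtain u where u: "q = mon u" "Poly_Mapping.keys u \<subseteq> {1..n}"
    "\<forall>k\<in>{1..n}. Poly_Mapping.lookup u k \<le> Poly_Mapping.lookup v k"
    by (auto simp: box_def less_Suc_eq_le)
  have "Poly_Mapping.lookup u k \<le> Poly_Mapping.lookup v k" for k
  proof (cases "k \<in> {1..n}")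
    case False
    then have "k \<notin> Poly_Mapping.keys u" using u(2) by blast
    then show ?thesis by (simp add: in_keys_iff)
  qed (use u(3) in blast)
  then have v: "v = u + (v - u)"
    by (intro poly_mapping_eqI) (simp add: Poly_Mapping.lookup_add Poly_Mapping.lookup_minus)
  have "Poly_Mapping.keys (v - u) \<subseteq> {1..n}"
    using assms by (auto simp: in_keys_iff Poly_Mapping.lookup_minus subset_iff)
  then have "mon (v - u) \<in> polys {1..n}"
    by (rule polys_mon)
  moreover have "(mon v :: 'a mpol) = mon u * mon (v - u)"
    using mon_add[of u "v - u"] v by simp
  ultimately show "q \<in> monomial_factors n (mon v)"
    using u by (auto simp: monomial_factors_def monomials_def factor_def poly_ring_simps carrier_poly_ring)
qed

text \<open>Spanning together with the count already gives independence by
  \<open>independent_mod_coinv\<close>. What remains is to pass from congruences modulo the ideal to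
  linear combinations of cosets.\<close>

lemma block_basis_criterion:
  fixes G :: "'a :: field mat set"
  assumes v: "Poly_Mapping.keys v \<subseteq> {1..n}"
    and G: "finite G" "G \<subseteq> carrier_mat n n"
    and span: "polys {1..n} \<subseteq> red (coinv_ideal n G) (box (\<lambda>k. Poly_Mapping.lookup v k + 1) {1..n})"
    and card: "(\<Prod>k=1..n. Poly_Mapping.lookup v k + 1) \<le> card G"
  shows "generates_block_basis n G (mon v)"
proof -
  define I where "I = coinv_ideal n G"
  define K where "K = box (\<lambda>k. Poly_Mapping.lookup v k + 1) {1..n}"
  define pr where "pr q = I +>\<^bsub>poly_ring n\<^esub> q" for q
  let ?B = "mon ` K :: 'a mpol set"
  have K: "finite K" "\<And>u. u \<in> K \<Longrightarrow> Poly_Mapping.keys u \<subseteq> {1..n}" "card K \<le> card G"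
    using card card_box_le[of "{1..n}" "\<lambda>k. Poly_Mapping.lookup v k + 1"]
    by (simp_all add: K_def finite_box) (simp add: box_def)
  have I: "ideal I (poly_ring n)"
    unfolding I_def by (rule ideal_coinv)
  interpret I: ideal I "poly_ring n" by (rule I)
  interpret V: vectorspace class_ring "quot_alg n I"
    by (rule vectorspace_quot_alg[OF I])
  have Q_simps: "carrier (quot_alg n I) = pr ` polys {1..n}"
    "add (quot_alg n I) = add (poly_ring n Quot I)" "zero (quot_alg n I) = I"
    by (auto simp: quot_alg_def Let_def FactRing_def A_RCOSETS_def' carrier_poly_ring pr_def)
  have pr_add: "pr f \<oplus>\<^bsub>quot_alg n I\<^esub> pr g = pr (f + g)"
    if "f \<in> polys {1..n}" "g \<in> polys {1..n}" for f g
    using ring_hom_add[OF I.rcos_ring_hom, of f g] that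
    by (simp add: Q_simps pr_def poly_ring_simps carrier_poly_ring)
  have pr_smult: "c \<odot>\<^bsub>quot_alg n I\<^esub> pr f = pr (const_pol c * f)" if "f \<in> polys {1..n}" for c f
    using ring_hom_mult[OF I.rcos_ring_hom, of "const_pol c" f] that
    by (simp add: quot_alg_def Let_def pr_def poly_ring_simps carrier_poly_ring)
  have pr_eq: "pr f = pr g \<longleftrightarrow> f - g \<in> I" if "f \<in> polys {1..n}" "g \<in> polys {1..n}" for f g
  proof -
    have "f \<ominus>\<^bsub>poly_ring n\<^esub> g = f - g"
    proof -
      have "\<ominus>\<^bsub>poly_ring n\<^esub> g = - g"
        by (rule I.minus_equality) (use that in \<open>auto simp: poly_ring_simps carrier_poly_ring\<close>)
      then show ?thesis by (simp add: a_minus_def poly_ring_simps)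
    qed
    then show ?thesis
      using I.quotient_eq_iff_same_a_r_cos[OF I, of f g] that
      by (simp add: pr_def carrier_poly_ring)
  qed
  have pr_0: "pr 0 = I"
    using I.a_rcos_zero[OF I, of 0] by (simp add: pr_def I_def)
  \<comment> \<open>Coefficients in \<open>lincomb\<close> belong to cosets. Injectivity of
    \<open>pr\<close> on \<open>B\<close> turns them into coefficients of representatives without
    merging terms.\<close>
  have lincomb: "V.lincomb a (pr ` B) = pr (\<Sum>b\<in>B. const_pol (a (pr b)) * b)"
    if "finite B" "B \<subseteq> polys {1..n}" "inj_on pr B" for a B
    using that
  proof (induction B rule: finite_induct)
    case empty
    then show ?case by (simp add: V.lincomb_def Q_simps pr_0)
  next
    case (insert b B)
    have "pr b \<notin> pr ` B"
      using insert by auto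
    then have "V.lincomb a (pr ` insert b B) = (a (pr b) \<odot>\<^bsub>quot_alg n I\<^esub> pr b) \<oplus>\<^bsub>quot_alg n I\<^esub> V.lincomb a (pr ` B)"
      unfolding V.lincomb_def image_insert using insert
      by (intro V.finsum_insert) (auto simp: Q_simps pr_smult subset_iff intro!: imageI polys_mult)
    also have "\<dots> = pr (const_pol (a (pr b)) * b + (\<Sum>b\<in>B. const_pol (a (pr b)) * b))"
      using insert by (simp add: pr_smult) (rule pr_add, auto intro!: polys_mult polys_sum)
    finally show ?case
      using insert by simp
  qed
  note indep = independent_mod_coinv[OF K(1,2) span[folded K_def] G K(3), folded I_def]
  have B: "?B \<subseteq> polys {1..n}" "finite ?B"
    using K by (auto intro: polys_mon)
  have inj_mon: "inj_on mon A" for A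
    by (rule inj_onI) (metis Poly_Mapping.keys_single singleton_inject zero_neq_one)
  have inj: "inj_on pr ?B"
  proof (rule inj_onI, safe)
    fix u w assume uw: "u \<in> K" "w \<in> K" "pr (mon u) = pr (mon w)"
    then have d: "mon u - mon w \<in> I"
      using B pr_eq[of "mon u" "mon w"] by auto
    show "(mon u :: 'a mpol) = mon w"
    proof (rule ccontr)
      assume "mon u \<noteq> (mon w :: 'a mpol)"
      then have ne: "u \<noteq> w" by auto
      \<comment> \<open>Two factors with the same class amount to the relation with coefficients 1
        and -1.\<close>
      define a :: "(nat \<Rightarrow>\<^sub>0 nat) \<Rightarrow> 'a" where "a = (\<lambda>x. if x = u then 1 else if x = w then - 1 else 0)"
      have "(\<Sum>x\<in>K. Poly_Mapping.single x (a x)) = (\<Sum>x\<in>{u, w}. Poly_Mapping.single x (a x))"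
        using uw K(1) by (intro sum.mono_neutral_right) (auto simp: a_def)
      also have "\<dots> = mon u - mon w"
        using ne by (simp add: a_def Poly_Mapping.single_uminus)
      finally have "a u = 0"
        using indep[of a u] d uw by simp
      then show False by (simp add: a_def)
    qed
  qed
  have "\<not> V.lin_dep (pr ` ?B)"
  proof
    assume "V.lin_dep (pr ` ?B)"
    then obtain A a x where A: "A \<subseteq> pr ` ?B" "V.lincomb a A = I" "x \<in> A" "a x \<noteq> 0"
      unfolding V.lin_dep_def by (auto simp: Q_simps)
    define C where "C = {u \<in> K. pr (mon u) \<in> A}"
    have C: "A = pr ` (mon ` C)" "C \<subseteq> K"
      using A(1) by (auto simp: C_def)
    have fC: "finite C"
      using C K(1) finite_subset by blast
    have CB: "mon ` C \<subseteq> ?B"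
      using C(2) by blast
    have "pr (\<Sum>b\<in>mon ` C. const_pol (a (pr b)) * b) = I"
      using A(2) lincomb[OF finite_imageI[OF fC] subset_trans[OF CB B(1)] inj_on_subset[OF inj CB], of a]
      unfolding C(1) by simp
    then have "pr (\<Sum>b\<in>mon ` C. const_pol (a (pr b)) * b) = pr 0"
      by (simp only: pr_0)
    moreover have "(\<Sum>b\<in>mon ` C. const_pol (a (pr b)) * b) \<in> polys {1..n}"
      using CB B(1) by (intro polys_sum polys_mult) auto
    ultimately have "(\<Sum>b\<in>mon ` C. const_pol (a (pr b)) * b) - 0 \<in> I"
      by (simp only: pr_eq polys_0)
    then have "(\<Sum>b\<in>mon ` C. const_pol (a (pr b)) * b) \<in> I"
      by simp
    also have "(\<Sum>b\<in>mon ` C. const_pol (a (pr b)) * b) = (\<Sum>u\<in>C. Poly_Mapping.single u (a (pr (mon u))))"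
      by (simp add: sum.reindex[OF inj_mon] flip: single_eq)
    \<comment> \<open>Extension by zero, since independence is known for relations indexed by all of
      \<open>K\<close>.\<close>
    also have "\<dots> = (\<Sum>u\<in>K. Poly_Mapping.single u (if u \<in> C then a (pr (mon u)) else 0))"
      using C K(1) by (intro sum.mono_neutral_cong_left) auto
    finally have rel: "(\<Sum>u\<in>K. Poly_Mapping.single u (if u \<in> C then a (pr (mon u)) else 0)) \<in> I" .
    have "(if u \<in> C then a (pr (mon u)) else 0) = 0" if "u \<in> K" for u
      by (rule indep[OF _ rel that])
    moreover obtain u where "u \<in> C" "x = pr (mon u)"
      using A(3) C by auto
    ultimately show False
      using A(4) C(2) by (metis subsetD)
  qed
  moreover have "V.gen_set (pr ` ?B)"
  proof
    show "V.span (pr ` ?B) \<subseteq> carrier (quot_alg n I)"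
      using B by (intro V.span_is_subset2) (auto simp: Q_simps)
    show "carrier (quot_alg n I) \<subseteq> V.span (pr ` ?B)"
    proof
      fix X assume "X \<in> carrier (quot_alg n I)"
      then obtain f where f: "X = pr f" "f \<in> polys {1..n}"
        by (auto simp: Q_simps)
      then have "f \<in> red (coinv_ideal n G) K"
        using span unfolding K_def by blast
      then obtain a where a: "f - (\<Sum>u\<in>K. Poly_Mapping.single u (a u)) \<in> I"
        using red_coefficients K(1) unfolding I_def by blast
      \<comment> \<open>Transfers the coefficients from exponents to cosets along the inverse of the
        injective map that sends an exponent to the class of its monomial.\<close>
      define c where "c Y = a (inv_into K (pr \<circ> mon) Y)" for Y
      have inj': "inj_on (pr \<circ> mon) K"
        by (rule comp_inj_on[OF inj_mon inj])
      have c: "c (pr (mon u)) = a u" if "u \<in> K" for u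
        using inv_into_f_f[OF inj' that] by (simp add: c_def)
      have "V.lincomb c (pr ` ?B) = pr (\<Sum>u\<in>K. Poly_Mapping.single u (a u))"
        using lincomb[OF B(2,1) inj, of c] c
        by (simp add: sum.reindex[OF inj_mon] single_eq[symmetric])
      also have "\<dots> = X"
        using a f K(2) pr_eq[of f "\<Sum>u\<in>K. Poly_Mapping.single u (a u)"]
        by (auto intro!: polys_sum polys_mon)
      finally show "X \<in> V.span (pr ` ?B)"
        unfolding V.span_def using B(2) by (intro CollectI exI[of _ c] exI[of _ "pr ` ?B"]) auto
    qed
  qed
  moreover have "pr ` ?B \<subseteq> carrier (quot_alg n I)"
    using B by (auto simp: Q_simps)
  ultimately have "V.basis (pr ` ?B)"
    unfolding V.basis_def by blast
  moreover have "mon v \<in> (monomials n :: 'a mpol set)"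
    using v by (auto simp: monomials_def)
  moreover have "monomial_factors n (mon v) = ?B"
    using monomial_factors_mon[OF v] by (simp add: K_def)
  ultimately show ?thesis
    using inj unfolding generates_block_basis_def Let_def I_def[symmetric] pr_def[abs_def] by simp
qed

section \<open>The order of the group\<close>

lemma GL_iff: "(A :: 'a :: field mat) \<in> GL n \<longleftrightarrow> A \<in> carrier_mat n n \<and> det A \<noteq> 0"
proof (intro iffI conjI)
  assume A: "A \<in> GL n"
  then show c: "A \<in> carrier_mat n n" by (simp add: GL_def)
  from A obtain B where "inverts_mat A B" "inverts_mat B A"
    by (auto simp: GL_def invertible_mat_def)
  then have AB: "A * B = 1\<^sub>m n" and BA: "B * A = 1\<^sub>m (dim_row B)"
    using c by (auto simp: inverts_mat_def)
  have "dim_col B = n" "dim_row B = n"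
    using arg_cong[OF AB, of dim_col] arg_cong[OF BA, of dim_col] c by auto
  then have "B \<in> carrier_mat n n" by auto
  then have "det A * det B = 1"
    using det_mult[OF c] AB by (metis det_one)
  then show "det A \<noteq> 0" by auto
next
  assume A: "A \<in> carrier_mat n n \<and> det A \<noteq> 0"
  then have "A \<in> Units (ring_mat TYPE('a) n ())"
    by (intro det_non_zero_imp_unit) auto
  with A show "A \<in> GL n"
    by (auto simp: GL_def invertible_mat_def inverts_mat_def Units_def ring_mat_def)
qed

text \<open>If a kernel vector had a nonzero entry at \<open>j\<close>, then the row whose only
  nonzero entry stands in column \<open>j\<close> would give a nonzero product.\<close>

lemma G_m1_det_nonzero:
  assumes C: "C \<in> G_m1 m n"
  shows "det (C :: 'a :: field mat) \<noteq> 0"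
proof
  assume "det C = 0"
  have c: "C \<in> carrier_mat n n" using C by (simp add: G_m1_def)
  with \<open>det C = 0\<close> obtain v where v: "v \<in> carrier_vec n" "v \<noteq> 0\<^sub>v n" "C *\<^sub>v v = 0\<^sub>v n"
    using det_0_iff_vec_prod_zero_field by blast
  then obtain j where j: "j < n" "v $ j \<noteq> 0"
    by (metis carrier_vecD eq_vecI index_zero_vec)
  have "\<exists>!i. i < n \<and> C $$ (i, j) \<noteq> 0"
    using C j(1) by (simp add: G_m1_def)
  then obtain i where i: "i < n" "C $$ (i, j) \<noteq> 0"
    by blast
  have "\<exists>!k. k < n \<and> C $$ (i, k) \<noteq> 0"
    using C i(1) by (simp add: G_m1_def)
  then have 0: "C $$ (i, k) = 0" if "k < n" "k \<noteq> j" for k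
    using i j(1) that by blast
  have "(C *\<^sub>v v) $ i = (\<Sum>k\<in>{0..<n}. C $$ (i, k) * v $ k)"
    using c v(1) i by (simp add: scalar_prod_def)
  also have "\<dots> = (\<Sum>k\<in>{0..<n}. if k = j then C $$ (i, k) * v $ k else 0)"
    using 0 by (intro sum.cong) auto
  also have "\<dots> = C $$ (i, j) * v $ j"
    using j by simp
  finally show False
    using i j v(3) by simp
qed

lemma G_m1_carrier: "C \<in> G_m1 m n \<Longrightarrow> C \<in> carrier_mat n n"
  by (simp add: G_m1_def)

lemma G_I_carrier: "G_I m n1 n2 \<subseteq> carrier_mat (n1 + n2) (n1 + n2)"
  by (auto simp: G_I_def GL_def G_m1_def)

lemma G_I_det_nonzero: "g \<in> G_I m n1 n2 \<Longrightarrow> det g \<noteq> 0"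
  by (auto simp: G_I_def GL_iff G_m1_det_nonzero G_m1_carrier det_four_block_mat_lower_left_zero[where m = n2])

section \<open>Counting matrices and independent lists over a finite field\<close>

lemma card_carrier_mat: "card (carrier_mat r k :: 'a :: finite mat set) = CARD('a) ^ (r * k)"
  and finite_carrier_mat: "finite (carrier_mat r k :: 'a :: finite mat set)"
proof -
  let ?X = "{0..<r} \<times> {0..<k}"
  have "bij_betw (\<lambda>f. mat r k f) (?X \<rightarrow>\<^sub>E UNIV) (carrier_mat r k :: 'a mat set)"
  proof (rule bij_betwI')
    fix f g :: "nat \<times> nat \<Rightarrow> 'a"
    assume fg: "f \<in> ?X \<rightarrow>\<^sub>E UNIV" "g \<in> ?X \<rightarrow>\<^sub>E UNIV"
    show "mat r k f = mat r k g \<longleftrightarrow> f = g"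
    proof
      assume eq: "mat r k f = mat r k g"
      show "f = g"
      proof (rule PiE_ext[OF fg])
        fix x assume "x \<in> ?X"
        then show "f x = g x"
          using arg_cong[OF eq, of "\<lambda>A. A $$ x"] by auto
      qed
    qed simp
  next
    fix A :: "'a mat" assume A: "A \<in> carrier_mat r k"
    have "A = mat r k (restrict (\<lambda>x. A $$ x) ?X)"
      using A by (intro eq_matI) auto
    moreover have "restrict (\<lambda>x. A $$ x) ?X \<in> ?X \<rightarrow>\<^sub>E UNIV"
      unfolding restrict_PiE_iff by simp
    ultimately show "\<exists>f\<in>?X \<rightarrow>\<^sub>E UNIV. A = mat r k f"
      by (rule bexI)
  qed auto
  from bij_betw_same_card[OF this] bij_betw_finite[OF this]
  show "card (carrier_mat r k :: 'a mat set) = CARD('a) ^ (r * k)"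
    and "finite (carrier_mat r k :: 'a mat set)"
    by (auto simp: card_PiE finite_PiE)
qed

lemma card_carrier_vec: "card (carrier_vec n :: 'a :: finite vec set) = CARD('a) ^ n"
  and finite_carrier_vec: "finite (carrier_vec n :: 'a :: finite vec set)"
proof -
  have "bij_betw (\<lambda>A. col A 0) (carrier_mat n 1) (carrier_vec n :: 'a vec set)"
  proof (rule bij_betwI[where g = "\<lambda>v. mat_of_cols n [v]"])
    show "mat_of_cols n [col A 0] = A" if "A \<in> carrier_mat n 1" for A :: "'a mat"
      using that by (intro eq_matI) (auto simp: mat_of_cols_index)
  qed (auto simp: col_mat_of_cols)
  from bij_betw_same_card[OF this] bij_betw_finite[OF this]
  show "card (carrier_vec n :: 'a vec set) = CARD('a) ^ n"
    and "finite (carrier_vec n :: 'a vec set)"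
    by (auto simp: card_carrier_mat finite_carrier_mat)
qed

text \<open>Ordered independent families, to serve as the columns of a matrix. Coefficients are
  attached to positions, so a list with a repeated vector is dependent.\<close>

definition indep_lists :: "nat \<Rightarrow> nat \<Rightarrow> 'a :: field vec list set" where
  "indep_lists n k = {vs. length vs = k \<and> set vs \<subseteq> carrier_vec n \<and>
     (\<forall>c. (\<forall>r<n. (\<Sum>i<k. c i * vs ! i $ r) = 0) \<longrightarrow> (\<forall>i<k. c i = 0))}"

lemma finite_indep_lists: "finite (indep_lists n k :: 'a :: {field, finite} vec list set)"
  by (rule finite_subset[OF _ finite_lists_length_eq[OF finite_carrier_vec[of n], of k]])
    (auto simp: indep_lists_def)

text \<open>The coefficient of \<open>v\<close> in a relation must vanish, as otherwise the relation
  could be solved for \<open>v\<close>; what is left is a relation among \<open>vs\<close>.\<close>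

lemma indep_lists_append:
  assumes vs: "vs \<in> indep_lists n k" and v: "v \<in> carrier_vec n"
    and new: "\<And>c. \<exists>r<n. v $ r \<noteq> (\<Sum>i<k. c i * vs ! i $ r)"
  shows "vs @ [v] \<in> indep_lists n (Suc k)"
proof -
  have len: "length vs = k" and car: "set vs \<subseteq> carrier_vec n"
    using vs unfolding indep_lists_def by blast+
  have *: "c i = 0" if c: "\<And>r. r < n \<Longrightarrow> (\<Sum>i<Suc k. c i * (vs @ [v]) ! i $ r) = 0" and i: "i < Suc k"
    for c i
  proof -
    have sum: "(\<Sum>i<k. c i * vs ! i $ r) + c k * v $ r = 0" if "r < n" for r
      using c[OF that] len by (simp add: nth_append)
    have ck: "c k = 0"
    proof (rule ccontr)
      assume ck: "c k \<noteq> 0"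
      have "v $ r = (\<Sum>i<k. (- c i / c k) * vs ! i $ r)" if "r < n" for r
      proof -
        have "v $ r = - (\<Sum>i<k. c i * vs ! i $ r) / c k"
          using sum[OF that] ck by (simp add: field_simps add_eq_0_iff)
        then show ?thesis
          by (simp add: sum_divide_distrib sum_negf)
      qed
      with new[of "\<lambda>i. - c i / c k"] show False by auto
    qed
    have "(\<forall>r<n. (\<Sum>i<k. c i * vs ! i $ r) = 0) \<longrightarrow> (\<forall>i<k. c i = 0)"
      using vs unfolding indep_lists_def mem_Collect_eq by (elim conjE) (erule spec)
    moreover have "\<forall>r<n. (\<Sum>i<k. c i * vs ! i $ r) = 0"
      using sum ck by simp
    ultimately have "\<forall>i<k. c i = 0"
      by (rule mp)
    with ck i show ?thesis by (cases "i = k") simp_all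
  qed
  have "\<forall>c. (\<forall>r<n. (\<Sum>i<Suc k. c i * (vs @ [v]) ! i $ r) = 0) \<longrightarrow> (\<forall>i<Suc k. c i = 0)"
    by (intro allI impI, rule *) blast+
  moreover have "length (vs @ [v]) = Suc k" "set (vs @ [v]) \<subseteq> carrier_vec n"
    using len v car by simp_all
  ultimately show ?thesis
    unfolding indep_lists_def mem_Collect_eq by (intro conjI)
qed

text \<open>The span of \<open>k\<close> vectors has at most q^k elements, which leaves at least q^n
  - q^k vectors for the next position. Once \<open>k\<close> reaches \<open>n\<close> the truncated
  difference is 0 and the bound is trivial.\<close>

lemma card_indep_lists_ge:
  "(\<Prod>j<k. CARD('a) ^ n - CARD('a) ^ j) \<le> card (indep_lists n k :: 'a :: {field, finite} vec list set)"
proof (induction k)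
  case 0
  have "[] \<in> (indep_lists n 0 :: 'a vec list set)"
    by (simp add: indep_lists_def)
  then show ?case
    using finite_indep_lists[of n 0, where 'a = 'a] by (simp add: Suc_le_eq card_gt_0_iff) blast
next
  case (Suc k)
  let ?L = "indep_lists n :: nat \<Rightarrow> 'a vec list set"
  \<comment> \<open>The span as an image of the functions on \<open>{..<k}\<close>, so that counting
    coefficients bounds its size.\<close>
  define sp where "sp vs = (\<lambda>c. vec n (\<lambda>r. \<Sum>i<k. c i * vs ! i $ r)) ` ({..<k} \<rightarrow>\<^sub>E UNIV)"
    for vs :: "'a vec list"
  have "CARD('a) ^ n - CARD('a) ^ k \<le> card (carrier_vec n - sp vs)" for vs
  proof -
    have "card (sp vs) \<le> card ({..<k} \<rightarrow>\<^sub>E (UNIV :: 'a set))"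
      unfolding sp_def by (intro card_image_le finite_PiE) auto
    also have "\<dots> = CARD('a) ^ k" by (simp add: card_PiE)
    finally have "card (sp vs) \<le> CARD('a) ^ k" .
    moreover have "sp vs \<subseteq> carrier_vec n"
      unfolding sp_def by (intro image_subsetI) simp
    moreover from this have "card (carrier_vec n - sp vs) = CARD('a) ^ n - card (sp vs)"
      using card_Diff_subset[of "sp vs" "carrier_vec n"] finite_subset[OF _ finite_carrier_vec, of "sp vs" n]
      by (simp add: card_carrier_vec)
    ultimately show ?thesis
      by simp
  qed
  then have "card (?L k) * (CARD('a) ^ n - CARD('a) ^ k) \<le> (\<Sum>vs\<in>?L k. card (carrier_vec n - sp vs))"
    using sum_bounded_below[of "?L k" "CARD('a) ^ n - CARD('a) ^ k" "\<lambda>vs. card (carrier_vec n - sp vs)"]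
    by simp
  also have "\<dots> = card (SIGMA vs : ?L k. carrier_vec n - sp vs)"
    by (intro card_SigmaI[symmetric] finite_indep_lists ballI finite_Diff finite_carrier_vec)
  also have "\<dots> \<le> card (?L (Suc k))"
  proof (rule card_inj_on_le)
    show "inj_on (\<lambda>(vs, v). vs @ [v]) (SIGMA vs : ?L k. carrier_vec n - sp vs)"
      by (auto intro: inj_onI)
    show "(\<lambda>(vs, v). vs @ [v]) ` (SIGMA vs : ?L k. carrier_vec n - sp vs) \<subseteq> ?L (Suc k)"
    proof safe
      fix vs v assume *: "vs \<in> ?L k" "v \<in> carrier_vec n" "v \<notin> sp vs"
      have "\<exists>r<n. v $ r \<noteq> (\<Sum>i<k. c i * vs ! i $ r)" for c
      proof (rule ccontr)
        assume "\<not> ?thesis"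
        then have "v = vec n (\<lambda>r. \<Sum>i<k. restrict c {..<k} i * vs ! i $ r)"
          using *(2) by (intro eq_vecI) auto
        then have "v \<in> sp vs"
          unfolding sp_def by (intro image_eqI[of _ _ "restrict c {..<k}"]) auto
        with *(3) show False by blast
      qed
      with * show "vs @ [v] \<in> ?L (Suc k)"
        by (intro indep_lists_append)
    qed
  qed (rule finite_indep_lists)
  finally have "card (?L k) * (CARD('a) ^ n - CARD('a) ^ k) \<le> card (?L (Suc k))" .
  with mult_le_mono1[OF Suc.IH] show ?case
    unfolding prod.lessThan_Suc by (rule order_trans)
qed

text \<open>Independent columns leave no kernel and hence a nonzero determinant, and a matrix
  determines its list of columns.\<close>

lemma card_GL_ge:
  "(\<Prod>j<n. CARD('a) ^ n - CARD('a) ^ j) \<le> card (GL n :: 'a :: {field, finite} mat set)"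
proof -
  have "card (indep_lists n n :: 'a vec list set) \<le> card (GL n :: 'a mat set)"
  proof (rule card_inj_on_le)
    show "inj_on (mat_of_cols n) (indep_lists n n :: 'a vec list set)"
      by (rule inj_on_inverseI[where g = cols]) (auto simp: indep_lists_def)
    show "mat_of_cols n ` indep_lists n n \<subseteq> (GL n :: 'a mat set)"
    proof safe
      fix vs :: "'a vec list" assume vs: "vs \<in> indep_lists n n"
      let ?A = "mat_of_cols n vs"
      have len: "length vs = n"
        using vs unfolding indep_lists_def by blast
      then have c: "?A \<in> carrier_mat n n"
        using mat_of_cols_carrier(1)[of n vs] by simp
      have "v = 0\<^sub>v n" if v: "v \<in> carrier_vec n" "?A *\<^sub>v v = 0\<^sub>v n" for v
      proof -
        have "(\<Sum>i<n. v $ i * vs ! i $ r) = 0" if "r < n" for r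
        proof -
          have "(?A *\<^sub>v v) $ r = (\<Sum>i\<in>{0..<n}. ?A $$ (r, i) * v $ i)"
            using v(1) len that by (simp add: scalar_prod_def)
          also have "\<dots> = (\<Sum>i<n. v $ i * vs ! i $ r)"
            using len that by (intro sum.cong) (auto simp: mat_of_cols_index)
          finally have "(?A *\<^sub>v v) $ r = (\<Sum>i<n. v $ i * vs ! i $ r)" .
          then show ?thesis using v(2) that by simp
        qed
        moreover have "(\<forall>r<n. (\<Sum>i<n. v $ i * vs ! i $ r) = 0) \<longrightarrow> (\<forall>i<n. v $ i = 0)"
          using vs unfolding indep_lists_def mem_Collect_eq by (elim conjE) (erule spec)
        ultimately have "\<forall>i<n. v $ i = 0"
          by simp
        then show ?thesis using v(1) by (intro eq_vecI) auto
      qed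
      then show "?A \<in> GL n"
        using c det_0_iff_vec_prod_zero_field[OF c] by (auto simp: GL_iff)
    qed
    show "finite (GL n :: 'a mat set)"
      by (rule finite_subset[OF _ finite_carrier_mat]) (auto simp: GL_def)
  qed
  with card_indep_lists_ge[of n n, where 'a = 'a] show ?thesis by linarith
qed

text \<open>A permutation and one root of unity per column define a monomial matrix. The roots are
  nonzero because \<open>m > 0\<close>, so the pattern of nonzero entries gives back the permutation
  and the entries give back the roots.\<close>

lemma card_G_m1_ge:
  fixes m :: nat
  assumes m: "m > 0" and W: "card {w :: 'a :: {field, finite}. w ^ m = 1} = m"
  shows "fact n * m ^ n \<le> card (G_m1 m n :: 'a mat set)"
proof -
  let ?W = "{w :: 'a. w ^ m = 1}"
  let ?D = "{\<sigma>. \<sigma> permutes {..<n}} \<times> ({..<n} \<rightarrow>\<^sub>E ?W)"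
  define M :: "(nat \<Rightarrow> nat) \<times> (nat \<Rightarrow> 'a) \<Rightarrow> 'a mat"
    where "M = (\<lambda>(\<sigma>, s). mat n n (\<lambda>(i, j). if i = \<sigma> j then s j else 0))"
  have W0: "w \<noteq> 0" if "w \<in> ?W" for w
    using that m by (auto simp: power_0_left)
  have M: "M (\<sigma>, s) $$ (i, j) = (if i = \<sigma> j then s j else 0)" if "i < n" "j < n" for \<sigma> s i j
    using that by (simp add: M_def)
  have "fact n * m ^ n = card ?D"
    using W by (simp add: card_cartesian_product card_permutations[of _ n] card_PiE)
  also have "card ?D \<le> card (G_m1 m n :: 'a mat set)"
  proof (rule card_inj_on_le)
    show "inj_on M ?D"
    proof (rule inj_onI, safe)
      fix \<sigma> \<sigma>' s s'
      assume p: "\<sigma> permutes {..<n}" "\<sigma>' permutes {..<n}"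
        and s: "s \<in> {..<n} \<rightarrow>\<^sub>E ?W" "s' \<in> {..<n} \<rightarrow>\<^sub>E ?W" and eq: "M (\<sigma>, s) = M (\<sigma>', s')"
      have *: "\<sigma> j = \<sigma>' j \<and> s j = s' j" if j: "j < n" for j
      proof -
        have "\<sigma> j < n" using permutes_in_image[OF p(1), of j] j by simp
        then have "s j = (if \<sigma> j = \<sigma>' j then s' j else 0)"
          using M[of "\<sigma> j" j \<sigma> s] M[of "\<sigma> j" j \<sigma>' s'] eq j by simp
        moreover have "s j \<noteq> 0" using s(1) j W0 by auto
        ultimately show ?thesis by (auto split: if_splits)
      qed
      show "\<sigma> = \<sigma>'"
      proof
        fix j show "\<sigma> j = \<sigma>' j"
          using * p by (cases "j < n") (auto simp: permutes_def)
      qed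
      show "s = s'"
        using s * by (intro PiE_ext[OF s]) auto
    qed
    show "M ` ?D \<subseteq> G_m1 m n"
    proof safe
      fix \<sigma> s assume p: "\<sigma> permutes {..<n}" and s: "s \<in> {..<n} \<rightarrow>\<^sub>E ?W"
      have s0: "s j \<noteq> 0" "s j ^ m = 1" if "j < n" for j
        using s W0 that by auto
      have \<sigma>: "\<sigma> j < n" if "j < n" for j
        using permutes_in_image[OF p, of j] that by simp
      have "\<exists>!j. j < n \<and> M (\<sigma>, s) $$ (i, j) \<noteq> 0" if i: "i < n" for i
      proof -
        have "\<exists>!j. j < n \<and> \<sigma> j = i"
        \<comment> \<open>The nonzero entry of row \<open>i\<close> stands in the column that the
          permutation sends to \<open>i\<close>.\<close>
        proof (rule ex1I[of _ "inv_into UNIV \<sigma> i"])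
          show "inv_into UNIV \<sigma> i < n \<and> \<sigma> (inv_into UNIV \<sigma> i) = i"
            using permutes_in_image[OF permutes_inv[OF p], of i] permutes_inverses[OF p] i by simp
        qed (use permutes_inverses[OF p] in auto)
        moreover have "j < n \<and> M (\<sigma>, s) $$ (i, j) \<noteq> 0 \<longleftrightarrow> j < n \<and> \<sigma> j = i" for j
          using i s0 by (auto simp: M split: if_splits)
        ultimately show ?thesis by simp
      qed
      moreover have "\<exists>!i. i < n \<and> M (\<sigma>, s) $$ (i, j) \<noteq> 0" if j: "j < n" for j
        using j \<sigma>[OF j] s0[OF j] by (intro ex1I[of _ "\<sigma> j"]) (auto simp: M split: if_splits)
      ultimately show "M (\<sigma>, s) \<in> G_m1 m n"
        using s0 by (auto simp: G_m1_def M) (simp add: M_def)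
    qed
    show "finite (G_m1 m n :: 'a mat set)"
      by (rule finite_subset[OF _ finite_carrier_mat]) (auto simp: G_m1_def)
  qed
  finally show ?thesis .
qed

lemma finite_G_I: "finite (G_I m n1 n2 :: 'a :: {field, finite} mat set)"
  by (rule finite_subset[OF G_I_carrier finite_carrier_mat])

lemma card_G_I_ge:
  "card (GL n1 :: 'a :: {field, finite} mat set) * CARD('a) ^ (n1 * n2) * card (G_m1 m n2 :: 'a mat set)
    \<le> card (G_I m n1 n2 :: 'a mat set)"
proof -
  let ?D = "(GL n1 :: 'a mat set) \<times> (carrier_mat n1 n2 :: 'a mat set) \<times> (G_m1 m n2 :: 'a mat set)"
  let ?M = "\<lambda>(A, B, C). four_block_mat A B (0\<^sub>m n2 n1) C :: 'a mat"
  have "card ?D \<le> card (G_I m n1 n2 :: 'a mat set)"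
  proof (rule card_inj_on_le[OF _ _ finite_G_I])
    show "?M ` ?D \<subseteq> G_I m n1 n2"
      by (auto simp: G_I_def)
    show "inj_on ?M ?D"
    proof (rule inj_onI, safe)
      fix A B C A' B' C' :: "'a mat"
      assume "A \<in> GL n1" "A' \<in> GL n1" "C \<in> G_m1 m n2" "C' \<in> G_m1 m n2"
        and B: "B \<in> carrier_mat n1 n2" "B' \<in> carrier_mat n1 n2"
        and eq: "four_block_mat A B (0\<^sub>m n2 n1) C = four_block_mat A' B' (0\<^sub>m n2 n1) C'"
      then have A: "A \<in> carrier_mat n1 n1" "A' \<in> carrier_mat n1 n1"
        and C: "C \<in> carrier_mat n2 n2" "C' \<in> carrier_mat n2 n2"
        by (auto simp: GL_def G_m1_def)
      have entry: "four_block_mat A B (0\<^sub>m n2 n1) C $$ ij = four_block_mat A' B' (0\<^sub>m n2 n1) C' $$ ij" for ij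
        by (simp only: eq)
      show "A = A'"
      proof (rule eq_matI)
        fix i j assume "i < dim_row A'" "j < dim_col A'"
        then show "A $$ (i, j) = A' $$ (i, j)" using entry[of "(i, j)"] A B C by simp
      qed (use A in auto)
      show "B = B'"
      proof (rule eq_matI)
        fix i j assume "i < dim_row B'" "j < dim_col B'"
        then show "B $$ (i, j) = B' $$ (i, j)" using entry[of "(i, n1 + j)"] A B C by simp
      qed (use B in auto)
      show "C = C'"
      proof (rule eq_matI)
        fix i j assume "i < dim_row C'" "j < dim_col C'"
        then show "C $$ (i, j) = C' $$ (i, j)" using entry[of "(n1 + i, n1 + j)"] A B C by simp
      qed (use C in auto)
    qed
  qed
  then show ?thesis
    by (simp add: card_cartesian_product card_carrier_mat mult.assoc)
qed

section \<open>Linear forms and orbits\<close>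

definition lin :: "nat set \<Rightarrow> (nat \<Rightarrow> 'a :: field) \<Rightarrow> 'a mpol" where
  "lin T a = (\<Sum>i\<in>T. const_pol (a i) * pvar i)"

definition linear_forms :: "nat set \<Rightarrow> 'a :: field mpol set" where
  "linear_forms T = range (lin T)"

lemma lookup_lin:
  "finite T \<Longrightarrow> Poly_Mapping.lookup (lin T a) (Poly_Mapping.single k 1) = (if k \<in> T then a k else 0)"
  by (simp add: lin_def Poly_Mapping.lookup_sum const_pol_def pvar_def single_1_eq_iff
      Poly_Mapping.mult_single Poly_Mapping.lookup_single when_def)

lemma lin_cong: "(\<And>i. i \<in> T \<Longrightarrow> a i = b i) \<Longrightarrow> lin T a = lin T b"
  unfolding lin_def by (rule sum.cong) auto

lemma lin_mono_neutral:
  "finite T \<Longrightarrow> S \<subseteq> T \<Longrightarrow> (\<And>i. i \<in> T - S \<Longrightarrow> a i = 0) \<Longrightarrow> lin S a = lin T a"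
  unfolding lin_def by (rule sum.mono_neutral_left) auto

lemma linear_forms_mono:
  assumes "finite T" "S \<subseteq> T"
  shows "linear_forms S \<subseteq> linear_forms T"
proof
  fix f :: "'a mpol" assume "f \<in> linear_forms S"
  then obtain a where f: "f = lin S a" by (auto simp: linear_forms_def)
  let ?b = "\<lambda>i. if i \<in> S then a i else 0"
  have "lin S a = lin S ?b" by (rule lin_cong) simp
  also have "\<dots> = lin T ?b" using assms by (intro lin_mono_neutral) auto
  finally show "f \<in> linear_forms T" using f by (auto simp: linear_forms_def)
qed

lemma lin_add: "lin T a + lin T b = lin T (\<lambda>i. a i + b i)"
  by (simp add: lin_def const_pol_add distrib_right sum.distrib)

lemma lin_scale: "const_pol c * lin T a = lin T (\<lambda>i. c * a i)"
  by (simp add: lin_def sum_distrib_left const_pol_mult mult.assoc)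

lemma linear_forms_add: "f \<in> linear_forms T \<Longrightarrow> g \<in> linear_forms T \<Longrightarrow> f + g \<in> linear_forms T"
  by (auto simp: linear_forms_def lin_add)

lemma linear_forms_scale: "f \<in> linear_forms T \<Longrightarrow> const_pol c * f \<in> linear_forms T"
  by (auto simp: linear_forms_def lin_scale)

lemma linear_forms_0: "0 \<in> linear_forms T"
  unfolding linear_forms_def by (rule range_eqI[of _ _ "\<lambda>_. 0"]) (simp add: lin_def)

lemma linear_forms_sum: "(\<And>i. i \<in> A \<Longrightarrow> f i \<in> linear_forms T) \<Longrightarrow> (\<Sum>i\<in>A. f i) \<in> linear_forms T"
  by (induction A rule: infinite_finite_induct) (auto simp: linear_forms_add linear_forms_0)

lemma pvar_eq_lin: "finite T \<Longrightarrow> k \<in> T \<Longrightarrow> pvar k = lin T (\<lambda>i. if i = k then 1 else 0)"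
  by (simp add: lin_def if_distrib[of const_pol] if_distrib[of "\<lambda>x. x * y" for y] cong: if_cong)

lemma pvar_linear_form: "finite T \<Longrightarrow> k \<in> T \<Longrightarrow> pvar k \<in> linear_forms T"
  using pvar_eq_lin[of T k] by (auto simp: linear_forms_def)

lemma linear_forms_polys: "linear_forms T \<subseteq> polys T"
  by (auto simp: linear_forms_def lin_def intro!: polys_sum polys_mult)

lemma homogeneous_linear_form: "f \<in> linear_forms T \<Longrightarrow> homogeneous 1 f"
  using homogeneous_mult[OF homogeneous_const homogeneous_pvar]
  by (auto simp: linear_forms_def lin_def intro!: homogeneous_sum)

lemma polys_lookup_linear:
  "f \<in> polys T \<Longrightarrow> Poly_Mapping.lookup f (Poly_Mapping.single k 1) \<noteq> 0 \<Longrightarrow> k \<in> T"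
  by (auto simp: polys_def simp flip: in_keys_iff)

text \<open>The coefficients of a form can be read off at the variables. This identifies, and so
  counts, the forms that \<open>orbit_relation\<close> divides off.\<close>

lemma linear_forms_Int_polys:
  assumes "finite T"
  shows "linear_forms T \<inter> polys S = linear_forms (T \<inter> S)"
proof (intro equalityI subsetI)
  fix f :: "'a mpol" assume "f \<in> linear_forms T \<inter> polys S"
  then obtain a where f: "f = lin T a" "f \<in> polys S" by (auto simp: linear_forms_def)
  have "a i = 0" if "i \<in> T - T \<inter> S" for i
    using polys_lookup_linear[OF f(2)[unfolded f(1)], of i] that
    unfolding lookup_lin[OF assms] by auto
  then have "lin (T \<inter> S) a = f"
    unfolding f(1) using assms by (intro lin_mono_neutral) auto
  then show "f \<in> linear_forms (T \<inter> S)" by (auto simp: linear_forms_def)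
next
  fix f :: "'a mpol" assume f: "f \<in> linear_forms (T \<inter> S)"
  then show "f \<in> linear_forms T \<inter> polys S"
    using linear_forms_mono[of T "T \<inter> S"] assms linear_forms_polys[of "T \<inter> S"] polys_mono[of "T \<inter> S" S]
    by blast
qed

lemma card_linear_forms: "finite T \<Longrightarrow> card (linear_forms T :: 'a :: {field, finite} mpol set) = CARD('a) ^ card T"
  and finite_linear_forms: "finite T \<Longrightarrow> finite (linear_forms T :: 'a :: {field, finite} mpol set)"
proof -
  assume T: "finite T"
  have "bij_betw (lin T) (T \<rightarrow>\<^sub>E (UNIV :: 'a set)) (linear_forms T)"
    unfolding bij_betw_def
  proof
    show "inj_on (lin T) (T \<rightarrow>\<^sub>E (UNIV :: 'a set))"
    proof (rule inj_onI)
      fix a b :: "nat \<Rightarrow> 'a" assume ab: "a \<in> T \<rightarrow>\<^sub>E UNIV" "b \<in> T \<rightarrow>\<^sub>E UNIV" "lin T a = lin T b"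
      show "a = b"
      proof (rule PiE_ext[OF ab(1,2)])
        fix i assume "i \<in> T"
        then show "a i = b i"
          using lookup_lin[OF T, of a i] lookup_lin[OF T, of b i] ab(3) by simp
      qed
    qed
    show "lin T ` (T \<rightarrow>\<^sub>E (UNIV :: 'a set)) = linear_forms T"
    proof (intro equalityI subsetI)
      fix f :: "'a mpol" assume "f \<in> linear_forms T"
      then obtain a where "f = lin T a" by (auto simp: linear_forms_def)
      also have "\<dots> = lin T (restrict a T)" by (rule lin_cong) simp
      finally show "f \<in> lin T ` (T \<rightarrow>\<^sub>E (UNIV :: 'a set))"
        by (intro image_eqI[of f "lin T" "restrict a T"]) (auto simp: restrict_PiE_iff)
    qed (auto simp: linear_forms_def)
  qed
  from bij_betw_same_card[OF this] bij_betw_finite[OF this] T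
  show "card (linear_forms T :: 'a mpol set) = CARD('a) ^ card T"
    and "finite (linear_forms T :: 'a mpol set)"
    by (auto simp: card_PiE finite_PiE)
qed

lemma act_lin:
  "act n g (lin {1..n} a) = lin {1..n} (\<lambda>i. \<Sum>k=1..n. g $$ (i - 1, k - 1) * a k)"
proof -
  interpret comm_ring_hom "act n g" by (rule act_comm_ring_hom)
  have "act n g (lin {1..n} a) = (\<Sum>k=1..n. const_pol (a k) * lin_image n g k)"
    unfolding lin_def hom_sum by (intro sum.cong) (auto simp: act_mult act_pvar)
  also have "\<dots> = (\<Sum>i=1..n. \<Sum>k=1..n. const_pol (a k) * (const_pol (g $$ (i - 1, k - 1)) * pvar i))"
    unfolding lin_image_def sum_distrib_left by (rule sum.swap)
  also have "\<dots> = lin {1..n} (\<lambda>i. \<Sum>k=1..n. g $$ (i - 1, k - 1) * a k)"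
    unfolding lin_def const_pol_sum sum_distrib_right
    by (intro sum.cong) (auto simp: const_pol_mult mult_ac)
  finally show ?thesis .
qed

text \<open>On coefficient vectors the action is multiplication by the matrix, up to the shift
  between variables counted from 1 and entries counted from 0.\<close>

lemma act_inj_on_linear_forms:
  assumes g: "g \<in> carrier_mat n n" "det g \<noteq> 0"
  shows "inj_on (act n g) (linear_forms {1..n})"
proof (rule inj_onI)
  fix f f' assume "f \<in> linear_forms {1..n}" "f' \<in> linear_forms {1..n}" and eq: "act n g f = act n g f'"
  then obtain a b where f: "f = lin {1..n} a" "f' = lin {1..n} b" by (auto simp: linear_forms_def)
  let ?v = "vec n (\<lambda>k. a (Suc k) - b (Suc k))"
  have "g *\<^sub>v ?v = 0\<^sub>v n"
  proof (rule eq_vecI)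
    fix i assume i: "i < dim_vec (0\<^sub>v n)"
    have "(\<Sum>k=1..n. g $$ (i, k - 1) * a k) = (\<Sum>k=1..n. g $$ (i, k - 1) * b k)"
      using arg_cong[OF eq[unfolded f act_lin], of "\<lambda>f. Poly_Mapping.lookup f (Poly_Mapping.single (Suc i) 1)"] i
      by (simp only: lookup_lin finite_atLeastAtMost) simp
    moreover have "(g *\<^sub>v ?v) $ i = (\<Sum>k\<in>{0..<n}. g $$ (i, k) * (a (Suc k) - b (Suc k)))"
      using g i by (simp add: scalar_prod_def)
    moreover have "\<dots> = (\<Sum>k=1..n. g $$ (i, k - 1) * (a k - b k))"
      by (rule sum.reindex_bij_witness[of _ "\<lambda>k. k - 1" Suc]) auto
    ultimately show "(g *\<^sub>v ?v) $ i = 0\<^sub>v n $ i"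
      using i by (simp add: right_diff_distrib sum_subtractf)
  qed (use g in auto)
  then have "?v = 0\<^sub>v n"
    using det_0_iff_vec_prod_zero_field[OF g(1)] g(2) vec_carrier[of n] by blast
  then have 0: "a (Suc k) - b (Suc k) = 0" if "k < n" for k
  proof -
    have "?v $ k = 0"
      unfolding \<open>?v = 0\<^sub>v n\<close> using that by simp
    then show ?thesis using that by simp
  qed
  show "f = f'"
    unfolding f
  proof (rule lin_cong)
    fix i assume i: "i \<in> {1..n}"
    then have "i - 1 < n" by auto
    with 0[OF this] i show "a i = b i" by simp
  qed
qed

text \<open>For \<open>J = {1..n2}\<close> this is the second set of forms permuted by the group.
  \<open>J\<close> is a parameter because the members that lie in the first \<open>n1 + l\<close>
  variables form a set of the same shape.\<close>

definition top_forms :: "nat \<Rightarrow> nat \<Rightarrow> nat set \<Rightarrow> 'a :: field mpol set" where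
  "top_forms m n1 J = (\<lambda>(v, j, w). v + const_pol w * pvar (n1 + j)) `
     (linear_forms {1..n1} \<times> J \<times> {w. w ^ m = 1})"

lemma lookup_linear_form_beyond:
  assumes "v \<in> linear_forms {1..n1}" "i \<ge> 1"
  shows "Poly_Mapping.lookup v (Poly_Mapping.single (n1 + i) 1) = 0"
proof -
  from assms(1) obtain a where "v = lin {1..n1} a" by (auto simp: linear_forms_def)
  then show ?thesis
    using assms(2) by (simp only: lookup_lin finite_atLeastAtMost) simp
qed

lemma lookup_const_pvar:
  "Poly_Mapping.lookup (const_pol w * pvar k :: 'a :: comm_ring_1 mpol) (Poly_Mapping.single l 1)
    = (if l = k then w else 0)"
  by (simp add: const_pol_def pvar_def Poly_Mapping.mult_single Poly_Mapping.lookup_single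
      when_def single_1_eq_iff)

lemma lookup_top_form:
  assumes "v \<in> linear_forms {1..n1}" "j \<ge> 1"
  shows "Poly_Mapping.lookup (v + const_pol w * pvar (n1 + j)) (Poly_Mapping.single (n1 + i) 1)
    = (if i = j then w else Poly_Mapping.lookup v (Poly_Mapping.single (n1 + i) 1))"
  unfolding Poly_Mapping.lookup_add lookup_const_pvar
  using lookup_linear_form_beyond[OF assms] by simp

text \<open>The triple can be recovered from the form: \<open>w\<close> is nonzero, and its position
  beyond the first \<open>n1\<close> variables shows \<open>j\<close>.\<close>

lemma card_top_forms:
  fixes m :: nat
  assumes "m > 0" "finite J" "J \<subseteq> {1..}"
  shows "card (top_forms m n1 J :: 'a :: {field, finite} mpol set)
      = CARD('a) ^ n1 * (card J * card {w :: 'a. w ^ m = 1})"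
    and "finite (top_forms m n1 J :: 'a mpol set)"
proof -
  let ?D = "linear_forms {1..n1} \<times> J \<times> {w :: 'a. w ^ m = 1}"
  have "inj_on (\<lambda>(v, j, w). v + const_pol w * pvar (n1 + j)) ?D"
  proof (rule inj_onI)
    fix x x' :: "'a mpol \<times> nat \<times> 'a"
    obtain v j w v' j' w' where x: "x = (v, j, w)" "x' = (v', j', w')"
      by (cases x, cases x')
    assume "x \<in> ?D" "x' \<in> ?D" "(case x of (v, j, w) \<Rightarrow> v + const_pol w * pvar (n1 + j))
        = (case x' of (v, j, w) \<Rightarrow> v + const_pol w * pvar (n1 + j))"
    then have v: "v \<in> linear_forms {1..n1}" "v' \<in> linear_forms {1..n1}" and j: "j \<in> J" "j' \<in> J"
      and w: "w ^ m = 1" "w' ^ m = 1"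
      and eq: "v + const_pol w * pvar (n1 + j) = v' + const_pol w' * pvar (n1 + j')"
      unfolding x by auto
    have j1: "j \<ge> 1" "j' \<ge> 1" using j assms(3) by auto
    have "w \<noteq> 0" using w assms(1) by (auto simp: power_0_left)
    have "w = (if j = j' then w' else 0)"
      using arg_cong[OF eq, of "\<lambda>f. Poly_Mapping.lookup f (Poly_Mapping.single (n1 + j) 1)"]
      unfolding lookup_top_form[OF v(1) j1(1)] lookup_top_form[OF v(2) j1(2)]
        lookup_linear_form_beyond[OF v(2) j1(1)] by simp
    with \<open>w \<noteq> 0\<close> have "j = j'" "w = w'" by (auto split: if_splits)
    with eq show "x = x'" unfolding x by simp
  qed
  then show "card (top_forms m n1 J :: 'a mpol set) = CARD('a) ^ n1 * (card J * card {w :: 'a. w ^ m = 1})"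
    unfolding top_forms_def by (simp add: card_image card_cartesian_product card_linear_forms)
  show "finite (top_forms m n1 J :: 'a mpol set)"
    unfolding top_forms_def using assms by (intro finite_imageI finite_cartesian_product finite_linear_forms) auto
qed

lemma top_forms_linear:
  "J \<subseteq> {1..n2} \<Longrightarrow> top_forms m n1 J \<subseteq> linear_forms {1..n1 + n2}"
proof -
  assume J: "J \<subseteq> {1..n2}"
  have "linear_forms {1..n1} \<subseteq> (linear_forms {1..n1 + n2} :: 'a mpol set)"
    by (rule linear_forms_mono) auto
  moreover have "pvar (n1 + j) \<in> (linear_forms {1..n1 + n2} :: 'a mpol set)" if "j \<in> J" for j
    using that J by (intro pvar_linear_form) auto
  ultimately show ?thesis
    unfolding top_forms_def by (auto intro!: linear_forms_add linear_forms_scale)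
qed

text \<open>As \<open>w\<close> is nonzero, the variable with index \<open>n1 + j\<close> really
  occurs in the form and must be among the permitted ones.\<close>

lemma top_forms_Int_polys:
  assumes "m > 0" "J \<subseteq> {1..}"
  shows "top_forms m n1 J \<inter> polys {1..n1 + l} = top_forms m n1 (J \<inter> {1..l})"
proof (intro equalityI subsetI)
  fix f :: "'a mpol" assume f: "f \<in> top_forms m n1 J \<inter> polys {1..n1 + l}"
  then obtain v j w where *: "f = v + const_pol w * pvar (n1 + j)" "v \<in> linear_forms {1..n1}" "j \<in> J" "w ^ m = 1"
    by (auto simp: top_forms_def)
  have "w \<noteq> 0" using *(4) assms(1) by (auto simp: power_0_left)
  moreover have j: "j \<ge> 1" using *(3) assms(2) by auto
  ultimately have "n1 + j \<in> {1..n1 + l}"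
    using f lookup_top_form[OF *(2) j, of w j] by (intro polys_lookup_linear[of f]) (auto simp: *(1))
  with * j show "f \<in> top_forms m n1 (J \<inter> {1..l})"
    unfolding top_forms_def by (intro image_eqI[of _ _ "(v, j, w)"]) auto
next
  fix f :: "'a mpol" assume f: "f \<in> top_forms m n1 (J \<inter> {1..l})"
  then have "f \<in> linear_forms {1..n1 + l}"
    using top_forms_linear[of "J \<inter> {1..l}" l m n1] by blast
  moreover have "top_forms m n1 (J \<inter> {1..l}) \<subseteq> (top_forms m n1 J :: 'a mpol set)"
    unfolding top_forms_def by (intro image_mono Sigma_mono) auto
  ultimately show "f \<in> top_forms m n1 J \<inter> polys {1..n1 + l}"
    using f linear_forms_polys by blast
qed

section \<open>Stability of the two sets of forms under the group\<close>

lemma G_I_cases: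
  assumes "g \<in> G_I m n1 n2"
  obtains A B C where "g = four_block_mat A B (0\<^sub>m n2 n1) C" "A \<in> carrier_mat n1 n1"
    "B \<in> carrier_mat n1 n2" "C \<in> carrier_mat n2 n2" "C \<in> G_m1 m n2"
  using assms by (auto simp: G_I_def GL_def dest: G_m1_carrier)

lemma sum_shift_split: "(\<Sum>i=1..n1 + n2. f i) = (\<Sum>i=1..n1. f i) + (\<Sum>i=1..n2. f (n1 + i :: nat))"
proof -
  have "(\<Sum>i=n1+1..n1+n2. f i) = (\<Sum>i=1..n2. f (n1 + i))"
    by (rule sum.reindex_bij_witness[of _ "\<lambda>i. n1 + i" "\<lambda>i. i - n1"]) auto
  then show ?thesis
    using sum.ub_add_nat[of 1 n1 f n2] by simp
qed

text \<open>The zero block in the lower left corner means that the images of the first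
  \<open>n1\<close> variables involve only these variables.\<close>

lemma act_linear_forms:
  assumes g: "g \<in> G_I m n1 n2" and v: "v \<in> linear_forms {1..n1}"
  shows "act (n1 + n2) g v \<in> linear_forms {1..n1}"
proof -
  interpret comm_ring_hom "act (n1 + n2) g" by (rule act_comm_ring_hom)
  from g obtain A B C where *: "g = four_block_mat A B (0\<^sub>m n2 n1) C" "A \<in> carrier_mat n1 n1"
    "B \<in> carrier_mat n1 n2" "C \<in> carrier_mat n2 n2" by (rule G_I_cases)
  have "act (n1 + n2) g (pvar k) \<in> linear_forms {1..n1}" if k: "k \<in> {1..n1}" for k
  proof -
    have "act (n1 + n2) g (pvar k) = lin_image (n1 + n2) g k"
      using k by (intro act_pvar) auto
    also have "\<dots> = lin {1..n1} (\<lambda>i. g $$ (i - 1, k - 1))"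
    proof -
      have "g $$ (i - 1, k - 1) = 0" if "i \<in> {1..n1 + n2} - {1..n1}" for i
        using that k * by auto
      then show ?thesis
        unfolding lin_image_def lin_def by (intro sum.mono_neutral_right) auto
    qed
    finally show ?thesis by (auto simp: linear_forms_def)
  qed
  moreover obtain a where "v = lin {1..n1} a" using v by (auto simp: linear_forms_def)
  ultimately show ?thesis
    by (auto simp: lin_def hom_sum act_mult intro!: linear_forms_sum linear_forms_scale)
qed

text \<open>In the column that gives the image of an upper variable, the \<open>B\<close> part
  contributes a form in the first \<open>n1\<close> variables and the \<open>C\<close> part a single
  root of unity times an upper variable. The m-th roots of unity are closed under products.\<close>

lemma act_top_forms:
  assumes g: "g \<in> G_I m n1 n2" and f: "f \<in> top_forms m n1 {1..n2}"
  shows "act (n1 + n2) g f \<in> top_forms m n1 {1..n2}"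
proof -
  from g obtain A B C where *: "g = four_block_mat A B (0\<^sub>m n2 n1) C" "A \<in> carrier_mat n1 n1"
    "B \<in> carrier_mat n1 n2" "C \<in> carrier_mat n2 n2" "C \<in> G_m1 m n2" by (rule G_I_cases)
  from f obtain v j w where f: "f = v + const_pol w * pvar (n1 + j)" "v \<in> linear_forms {1..n1}"
    "j \<in> {1..n2}" "w ^ m = 1"
    by (auto simp: top_forms_def)
  have j: "j - 1 < n2" using f(3) by auto
  then have "\<exists>!i. i < n2 \<and> C $$ (i, j - 1) \<noteq> 0"
    using *(5) by (simp add: G_m1_def)
  then obtain i where i: "i < n2" "C $$ (i, j - 1) \<noteq> 0"
    and uniq: "\<And>i'. i' < n2 \<Longrightarrow> i' \<noteq> i \<Longrightarrow> C $$ (i', j - 1) = 0" by blast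
  let ?c = "C $$ (i, j - 1)" and ?b = "lin {1..n1} (\<lambda>i. g $$ (i - 1, n1 + j - 1))"
  have c: "?c ^ m = 1" using *(5) i j by (simp add: G_m1_def)
  have "act (n1 + n2) g (pvar (n1 + j)) = lin_image (n1 + n2) g (n1 + j)"
    using f(3) by (intro act_pvar) auto
  also have "\<dots> = ?b + (\<Sum>k=1..n2. const_pol (g $$ (n1 + k - 1, n1 + j - 1)) * pvar (n1 + k))"
    unfolding lin_image_def lin_def sum_shift_split ..
  \<comment> \<open>Only row \<open>i\<close> of the column of \<open>C\<close> contributes. Rows
    count from 0 and variables from 1, whence \<open>Suc i\<close>.\<close>
  also have "(\<Sum>k=1..n2. const_pol (g $$ (n1 + k - 1, n1 + j - 1)) * pvar (n1 + k))
      = (\<Sum>k=1..n2. if k = Suc i then const_pol ?c * pvar (n1 + Suc i) else 0)"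
  proof (rule sum.cong)
    fix k assume k: "k \<in> {1..n2}"
    have "g $$ (n1 + k - 1, n1 + j - 1) = C $$ (k - 1, j - 1)"
      using * k f(3) by auto
    then show "const_pol (g $$ (n1 + k - 1, n1 + j - 1)) * pvar (n1 + k)
        = (if k = Suc i then const_pol ?c * pvar (n1 + Suc i) else 0)"
      using uniq[of "k - 1"] k by auto
  qed simp
  also have "\<dots> = const_pol ?c * pvar (n1 + Suc i)"
    using i by simp
  finally have "act (n1 + n2) g f = (act (n1 + n2) g v + const_pol w * ?b) + const_pol (w * ?c) * pvar (n1 + Suc i)"
    by (simp add: f(1) act_add act_mult const_pol_mult algebra_simps)
  moreover have "act (n1 + n2) g v + const_pol w * ?b \<in> linear_forms {1..n1}"
    using act_linear_forms[OF g f(2)] by (intro linear_forms_add linear_forms_scale) (auto simp: linear_forms_def)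
  moreover have "(w * ?c) ^ m = 1" using c f(4) by (simp add: power_mult_distrib)
  ultimately show ?thesis
    unfolding top_forms_def using i by (intro image_eqI[of _ _ "(_, Suc i, w * ?c)"]) auto
qed

text \<open>An injective self-map of a finite set is onto, so one inclusion is enough for
  stability.\<close>

lemma act_image_eq:
  fixes \<Omega> :: "'a :: {field, finite} mpol set"
  assumes g: "g \<in> G_I m n1 n2" and \<Omega>: "finite \<Omega>" "\<Omega> \<subseteq> linear_forms {1..n1 + n2}"
    and maps: "\<And>f. f \<in> \<Omega> \<Longrightarrow> act (n1 + n2) g f \<in> \<Omega>"
  shows "act (n1 + n2) g ` \<Omega> = \<Omega>"
proof (rule endo_inj_surj[OF \<Omega>(1)])
  show "inj_on (act (n1 + n2) g) \<Omega>"
    using act_inj_on_linear_forms[of g "n1 + n2"] G_I_carrier G_I_det_nonzero[OF g] g \<Omega>(2)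
    by (meson inj_on_subset subsetD)
qed (use maps in blast)

lemma pvar_notin_polys: "k \<notin> T \<Longrightarrow> pvar k \<notin> (polys T :: 'a :: comm_ring_1 mpol set)"
  by (simp add: polys_def pvar_def)

text \<open>Of the q^n1 forms in the first \<open>n1\<close> variables, q^(n1-j) involve only
  variables after x_j. For \<open>j = n1\<close> this is the zero form alone, and the degree is q^n1
  - 1.\<close>

lemma lower_relation:
  fixes n1 n2 m j :: nat
  defines "J \<equiv> coinv_ideal (n1 + n2) (G_I m n1 n2 :: 'a :: {field, finite} mat set)"
    and "e \<equiv> CARD('a) ^ n1 - CARD('a) ^ (n1 - j)"
  assumes j: "j \<in> {1..n1}"
  shows "\<exists>c. (\<forall>i. c i \<in> polys {j+1..n1}) \<and> pvar j ^ e + (\<Sum>i<e. c i * pvar j ^ i) \<in> J"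
proof -
  let ?\<Omega> = "linear_forms {1..n1} :: 'a mpol set"
  have sub: "?\<Omega> \<subseteq> linear_forms {1..n1 + n2}" by (rule linear_forms_mono) auto
  have "{1..n1} \<inter> {j+1..n1} = {j+1..n1}" by auto
  then have e: "card ?\<Omega> - card (?\<Omega> \<inter> polys {j+1..n1}) = e"
    by (simp add: linear_forms_Int_polys card_linear_forms e_def)
  show ?thesis
    unfolding J_def e[symmetric]
  proof (rule orbit_relation)
    show "?\<Omega> \<subseteq> polys {1..n1 + n2}" using sub linear_forms_polys by blast
    show "act (n1 + n2) g ` ?\<Omega> = ?\<Omega>" if "g \<in> G_I m n1 n2" for g
      using act_image_eq[OF that finite_linear_forms sub act_linear_forms[OF that]] by simp
    show "homogeneous 1 w" if "w \<in> ?\<Omega>" for w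
      using that by (rule homogeneous_linear_form)
  qed (use j in \<open>auto simp: finite_linear_forms pvar_notin_polys intro!: pvar_linear_form\<close>)
qed

text \<open>Of the m n2 q^n1 top forms, m (j-1) q^n1 lie in the first \<open>n1 + j - 1\<close>
  variables, and \<open>e\<close> is the difference.\<close>

lemma upper_relation:
  fixes n1 n2 m j :: nat
  defines "J \<equiv> coinv_ideal (n1 + n2) (G_I m n1 n2 :: 'a :: {field, finite} mat set)"
    and "e \<equiv> m * (n2 + 1 - j) * CARD('a) ^ n1"
  assumes m: "m > 0" "card {w :: 'a. w ^ m = 1} = m" and j: "j \<in> {1..n2}"
  shows "\<exists>c. (\<forall>i. c i \<in> polys {1..n1+(j-1)}) \<and> pvar (n1 + j) ^ e + (\<Sum>i<e. c i * pvar (n1 + j) ^ i) \<in> J"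
proof -
  let ?\<Omega> = "top_forms m n1 {1..n2} :: 'a mpol set"
  have sub: "?\<Omega> \<subseteq> linear_forms {1..n1 + n2}" by (rule top_forms_linear) auto
  have fin: "finite ?\<Omega>" using m by (intro card_top_forms) auto
  have "{1..n2} \<inter> {1..j-1} = {1..j-1}" "{1..n2} \<subseteq> {1..}" using j by auto
  from top_forms_Int_polys[OF m(1) this(2), of n1 "j - 1", where 'a = 'a, unfolded this(1)]
  have "card ?\<Omega> - card (?\<Omega> \<inter> polys {1..n1+(j-1)}) = CARD('a) ^ n1 * (n2 * m) - CARD('a) ^ n1 * ((j - 1) * m)"
    using m by (simp add: card_top_forms)
  also have "\<dots> = CARD('a) ^ n1 * ((n2 - (j - 1)) * m)"
    by (simp add: diff_mult_distrib diff_mult_distrib2)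
  also have "\<dots> = e" using j by (simp add: e_def mult_ac)
  finally have e: "card ?\<Omega> - card (?\<Omega> \<inter> polys {1..n1+(j-1)}) = e" .
  show ?thesis
    unfolding J_def e[symmetric]
  proof (rule orbit_relation[OF fin])
    show "?\<Omega> \<subseteq> polys {1..n1 + n2}" using sub linear_forms_polys by blast
    show "homogeneous 1 w" if "w \<in> ?\<Omega>" for w
      using that sub homogeneous_linear_form by blast
    show "act (n1 + n2) g ` ?\<Omega> = ?\<Omega>" if "g \<in> G_I m n1 n2" for g
      by (rule act_image_eq[OF that fin sub]) (rule act_top_forms[OF that])
    show "pvar (n1 + j) \<in> ?\<Omega>"
      \<comment> \<open>The variable itself comes from the zero form and the root 1.\<close>
      unfolding top_forms_def using j linear_forms_0 by (intro image_eqI[of _ _ "(0, j, 1)"]) auto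
  qed (use j in \<open>auto intro!: pvar_notin_polys\<close>)
qed

section \<open>The block basis\<close>

text \<open>One more than the exponent in the given monomial: the degree of the relation for the
  variable, and also the number of exponents that the variable takes in the factors.\<close>

definition block_exp :: "nat \<Rightarrow> nat \<Rightarrow> nat \<Rightarrow> nat \<Rightarrow> nat \<Rightarrow> nat" where
  "block_exp q m n1 n2 k =
    (if k \<le> n1 then q ^ n1 - q ^ (n1 - k) else m * (n2 + 1 - (k - n1)) * q ^ n1)"

text \<open>Ensures that the truncated \<open>block_exp q m n1 n2 k - 1\<close> is a true
  predecessor, so that adding 1 restores the degree.\<close>

lemma block_exp_pos:
  assumes "q > 1" "m > 0" "k \<in> {1..n1 + n2}"
  shows "block_exp q m n1 n2 k > 0"
  using assms power_strict_increasing[of "n1 - k" n1 q] by (auto simp: block_exp_def)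

lemma prod_shift_split: "(\<Prod>i=1..n1 + n2. f i) = (\<Prod>i=1..n1. f i) * (\<Prod>i=1..n2. f (n1 + i :: nat))"
proof -
  have "(\<Prod>i=n1+1..n1+n2. f i) = (\<Prod>i=1..n2. f (n1 + i))"
    by (rule prod.reindex_bij_witness[of _ "\<lambda>i. n1 + i" "\<lambda>i. i - n1"]) auto
  then show ?thesis
    using prod.ub_add_nat[of 1 n1 f n2] by simp
qed

text \<open>The three factors are the lower bounds for the orders of GL(n1), of the group of blocks
  B and of G(m,1,n2). The upper degrees contribute n2! from n2+1-j, and m q^n1 each.\<close>

lemma prod_block_exp:
  "(\<Prod>k=1..n1 + n2. block_exp q m n1 n2 k)
    = (\<Prod>j<n1. q ^ n1 - q ^ j) * q ^ (n1 * n2) * (fact n2 * m ^ n2)"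
proof -
  have "(\<Prod>k=1..n1. block_exp q m n1 n2 k) = (\<Prod>k=1..n1. q ^ n1 - q ^ (n1 - k))"
    by (rule prod.cong) (auto simp: block_exp_def)
  also have "\<dots> = (\<Prod>j<n1. q ^ n1 - q ^ j)"
    by (rule prod.reindex_bij_witness[of _ "\<lambda>j. n1 - j" "\<lambda>k. n1 - k"]) auto
  finally have 1: "(\<Prod>k=1..n1. block_exp q m n1 n2 k) = (\<Prod>j<n1. q ^ n1 - q ^ j)" .
  have "(\<Prod>j=1..n2. block_exp q m n1 n2 (n1 + j)) = (\<Prod>j=1..n2. (n2 + 1 - j) * (m * q ^ n1))"
    by (rule prod.cong) (auto simp: block_exp_def)
  also have "\<dots> = (\<Prod>j=1..n2. n2 + 1 - j) * (m * q ^ n1) ^ n2"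
    by (simp add: prod.distrib)
  also have "(\<Prod>j=1..n2. n2 + 1 - j) = (\<Prod>j=1..n2. j)"
    by (rule prod.reindex_bij_witness[of _ "\<lambda>j. n2 + 1 - j" "\<lambda>j. n2 + 1 - j"]) auto
  also have "\<dots> = fact n2"
    by (simp add: fact_prod)
  finally have 2: "(\<Prod>j=1..n2. block_exp q m n1 n2 (n1 + j)) = fact n2 * (m * q ^ n1) ^ n2" .
  show ?thesis
    unfolding prod_shift_split 1 2 by (simp add: power_mult_distrib power_mult)
qed

lemma block_basis:
  fixes n1 n2 m :: nat and G :: "'a :: {field, finite} mat set"
  defines "e \<equiv> block_exp CARD('a) m n1 n2" and "G \<equiv> G_I m n1 n2"
  assumes m: "m > 0" "card {w :: 'a. w ^ m = 1} = m"
  shows "generates_block_basis (n1 + n2) G (\<Prod>k=1..n1 + n2. pvar k ^ (e k - 1))"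
proof -
  define n where "n = n1 + n2"
  define v where "v = (\<Sum>k=1..n. Poly_Mapping.single k (e k - 1))"
  have q: "CARD('a) > 1"
    using card_mono[of "UNIV :: 'a set" "{0, 1}"] by simp
  have lookup_v: "Poly_Mapping.lookup v k = (if k \<in> {1..n} then e k - 1 else 0)" for k
    by (simp add: v_def Poly_Mapping.lookup_sum Poly_Mapping.lookup_single when_def)
  then have ev: "Poly_Mapping.lookup v k + 1 = e k" if "k \<in> {1..n}" for k
    using block_exp_pos[OF q m(1), of k n1 n2] that by (simp add: e_def n_def)
  have keys_v: "Poly_Mapping.keys v \<subseteq> {1..n}"
    using lookup_v by (auto simp: in_keys_iff split: if_splits)
  \<comment> \<open>For indices in \<open>{1..n}\<close>, \<open>R a b\<close> says that x_b comes
    after x_a in the elimination list x_n, ..., x_(n1+1), x_1, ..., x_n1.\<close>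
  define R where "R a b \<longleftrightarrow> (if n1 < a then b < a else a < b \<and> b \<le> n1)" for a b :: nat
  define xs where "xs = rev [n1 + 1..<n + 1] @ [1..<n1 + 1]"
  have "sorted_wrt R (rev [n1 + 1..<n + 1])"
    unfolding sorted_wrt_rev by (rule sorted_wrt_mono_rel[OF _ sorted_wrt_upt]) (auto simp: R_def)
  moreover have "sorted_wrt R [1..<n1 + 1]"
    by (rule sorted_wrt_mono_rel[OF _ sorted_wrt_upt]) (auto simp: R_def)
  ultimately have sorted: "sorted_wrt R xs"
    by (auto simp: xs_def sorted_wrt_append R_def)
  have set_xs: "set xs = {1..n}"
    by (auto simp: xs_def n_def)
  have red: "f \<in> red (coinv_ideal n G) (box e (set xs))" if f: "f \<in> polys {1..n}" for f
  proof (rule triangular_reduction)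
    show "distinct xs" by (auto simp: xs_def)
    fix ys x zs assume xs: "xs = ys @ x # zs"
    then have x: "x \<in> {1..n}" using set_xs by auto
    \<comment> \<open>\<open>R\<close> is irreflexive and asymmetric, so a variable that it places
      after \<open>x\<close> is neither \<open>x\<close> nor in the sorted prefix
      \<open>ys\<close>.\<close>
    have tail: "y \<in> set zs" if "y \<in> {1..n}" "R x y" for y
    proof -
      have "y \<in> set xs" using that(1) set_xs by blast
      then have "y \<in> set ys \<or> y = x \<or> y \<in> set zs"
        unfolding xs by auto
      moreover have "\<not> R x x" by (simp add: R_def)
      moreover have "\<not> R y x" using that(2) unfolding R_def by (cases "n1 < x"; cases "n1 < y") auto
      moreover have "R y x" if "y \<in> set ys"
        using sorted that unfolding xs by (auto simp: sorted_wrt_append)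
      ultimately show ?thesis using that(2) by blast
    qed
    show "\<exists>c. (\<forall>i. c i \<in> polys (set zs)) \<and> pvar x ^ e x + (\<Sum>i<e x. c i * pvar x ^ i) \<in> coinv_ideal n G"
    proof (cases "x \<le> n1")
      case True
      have "polys {x+1..n1} \<subseteq> (polys (set zs) :: 'a mpol set)"
        using True by (intro polys_mono subsetI tail) (auto simp: R_def n_def)
      moreover have "e x = CARD('a) ^ n1 - CARD('a) ^ (n1 - x)"
        using True by (simp add: e_def block_exp_def)
      ultimately show ?thesis
        using lower_relation[of x n1 n2 m, where 'a = 'a] True x unfolding G_def n_def by auto
    next
      case False
      then obtain j where j: "x = n1 + j" "j \<in> {1..n2}"
        using x by (intro that[of "x - n1"]) (auto simp: n_def)
      have "polys {1..n1+(j-1)} \<subseteq> (polys (set zs) :: 'a mpol set)"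
        using j by (intro polys_mono subsetI tail) (auto simp: R_def n_def)
      moreover have "e x = m * (n2 + 1 - j) * CARD('a) ^ n1"
        using j by (simp add: e_def block_exp_def)
      ultimately show ?thesis
        using upper_relation[OF m j(2), of n1] unfolding G_def n_def j(1) by auto
    qed
  qed (use f set_xs in auto)
  have "generates_block_basis n G (mon v)"
  proof (rule block_basis_criterion[OF keys_v])
    show "finite G" "G \<subseteq> carrier_mat n n"
      unfolding G_def n_def by (rule finite_G_I G_I_carrier)+
    have "box (\<lambda>k. Poly_Mapping.lookup v k + 1) {1..n} = box e {1..n}"
      unfolding box_def using ev by auto
    then show "polys {1..n} \<subseteq> red (coinv_ideal n G) (box (\<lambda>k. Poly_Mapping.lookup v k + 1) {1..n})"
      using red unfolding set_xs by auto
    have "(\<Prod>k=1..n. Poly_Mapping.lookup v k + 1) = (\<Prod>k=1..n. e k)"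
      using ev by (intro prod.cong) auto
    also have "\<dots> = (\<Prod>j<n1. CARD('a) ^ n1 - CARD('a) ^ j) * CARD('a) ^ (n1 * n2) * (fact n2 * m ^ n2)"
      unfolding e_def n_def by (rule prod_block_exp)
    also have "\<dots> \<le> card (GL n1 :: 'a mat set) * CARD('a) ^ (n1 * n2) * card (G_m1 m n2 :: 'a mat set)"
      by (intro mult_mono card_GL_ge card_G_m1_ge m) auto
    also have "\<dots> \<le> card G"
      unfolding G_def by (rule card_G_I_ge)
    finally show "(\<Prod>k=1..n. Poly_Mapping.lookup v k + 1) \<le> card G" .
  qed
  also have "mon v = (\<Prod>k=1..n. pvar k ^ (e k - 1) :: 'a mpol)"
    using keys_v by (subst mon_eq_prod[of "{1..n}"]) (auto simp: lookup_v intro!: prod.cong)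
  finally show ?thesis by (simp add: n_def)
qed

text \<open>For \<open>m = 2\<close> the roots are 1 and -1, which must differ for both the size of
  \<open>top_forms\<close> and the order of G(m,1,n2) to come out right; this is where an odd
  characteristic enters.\<close>

lemma card_roots_of_unity_le_2:
  assumes "m \<in> {1, 2}" "m = 2 \<longrightarrow> (1 :: 'a :: field) \<noteq> - 1"
  shows "card {w :: 'a. w ^ m = 1} = m"
proof -
  have "{w :: 'a. w ^ 2 = 1} = {1, - 1}"
    by (auto simp: power2_eq_1_iff)
  with assms show ?thesis by auto
qed

theorem proposition6p6:
  fixes p n1 n2 n m :: nat
  assumes "CARD('p :: prime_card) = p"
    and "n1 \<ge> 1" and "n2 \<ge> 1" and "n = n1 + n2"
    and "m \<in> {1, 2}" and "m = 2 \<longrightarrow> odd p"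
  shows "generates_block_basis n (G_I m n1 n2 :: 'p mod_ring mat set)
    ((\<Prod>j=1..n1. pvar j ^ (p ^ n1 - p ^ (n1 - j) - 1)) *
     (\<Prod>j=1..n2. pvar (n1 + j) ^ (m * (n2 + 1 - j) * p ^ n1 - 1)))"
proof -
  let ?e = "block_exp p m n1 n2"
  have "(1 :: 'p mod_ring) \<noteq> - 1" if "m = 2"
  proof
    assume "(1 :: 'p mod_ring) = - 1"
    \<comment> \<open>In characteristic p the equation 1 = -1 says that p divides 2.\<close>
    then have "of_nat 2 = (0 :: 'p mod_ring)"
      by (simp add: eq_neg_iff_add_eq_0)
    then have "p dvd 2"
      using of_nat_0_mod_ring_dvd assms(1) by blast
    moreover have "p > 1"
      using prime_card[where 'a = 'p] assms(1) prime_gt_1_nat by blast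
    ultimately have "p = 2"
      using dvd_imp_le[of p 2] by simp
    with assms(6) that show False by simp
  qed
  then have "card {w :: 'p mod_ring. w ^ m = 1} = m"
    by (intro card_roots_of_unity_le_2 assms(5)) blast
  moreover have "m > 0" using assms(5) by auto
  ultimately have "generates_block_basis (n1 + n2) (G_I m n1 n2 :: 'p mod_ring mat set)
      (\<Prod>k=1..n1 + n2. pvar k ^ (?e k - 1))"
    using block_basis[where 'a = "'p mod_ring", of m n1 n2] assms(1) by simp
  also have "(\<Prod>k=1..n1 + n2. pvar k ^ (?e k - 1)) =
      (\<Prod>j=1..n1. pvar j ^ (p ^ n1 - p ^ (n1 - j) - 1)) *
      (\<Prod>j=1..n2. pvar (n1 + j) ^ (m * (n2 + 1 - j) * p ^ n1 - 1) :: 'p mod_ring mpol)"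
    unfolding prod_shift_split by (intro arg_cong2[of _ _ _ _ "(*)"] prod.cong) (auto simp: block_exp_def)
  finally show ?thesis
    using assms(4) by simp
qed

end
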